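(* Let $\delta\in\{\mathsf n,\mathsf u,\mathsf d,\mathsf{ud}\}^n$ be a decoration, and let $\equiv_\delta$ be the corresponding permutree congruence on $S_n$. The permutree stack-sorting operator $\mathbf S_{\equiv_\delta}:S_n\to S_n$ satisfies the identity $$\mathbf S_{\equiv_\delta}=\mathcal P\circ\mathcal I_\delta^{-1}.$$
   Context: Decorations are words over a four-letter alphabet: $\mathsf n$ (no wall), $\mathsf u$ (upward wall), $\mathsf d$ (downward wall), $\mathsf{ud}$ (both). In a directed tree, $u$ is a parent (child) of $v$ if there is an arrow $v\to u$ ($u\to v$), and an ancestor (descendant) of $v$ if there is a directed path with at least one arrow from $v$ to $u$ (from $u$ to $v$). Permutrees. For $\delta=\delta_1\cdots\delta_n$, a $\delta$-permutree is a directed plane tree $T$ with a bijection $p:V(T)\to[n]$ such that, for each vertex $v$: if $\delta_{p(v)}\in\{\mathsf n,\mathsf d\}$, $v$ has at most one parent; if $\delta_{p(v)}\in\{\mathsf n,\mathsf u\}$, $v$ has at most one child; if $\delta_{p(v)}\in\{\mathsf u,\mathsf{ud}\}$, $v$ has at most one parent $u$ with $p(u)<p(v)$, and if it exists every ancestor $u'$ of $u$ has $p(u')<p(v)$, and likewise $v$ has at most one parent $u$ with $p(u)>p(v)$, and if it exists every ancestor $u'$ of $u$ has $p(u')>p(v)$; if $\delta_{p(v)}\in\{\mathsf d,\mathsf{ud}\}$, $v$ has at most one child $u$ with $p(u)<p(v)$, and if it exists every descendant $u'$ of $u$ has $p(u')<p(v)$, and likewise $v$ has at most one child $u$ with $p(u)>p(v)$,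 and if it exists every descendant $u'$ of $u$ has $p(u')>p(v)$. $V(T)$ is partially ordered by $u\preceq v$ iff there is a directed path (possibly trivial) from $u$ to $v$. A linear extension of $V(T)$ is a bijection $\sigma:V(T)\to[n]$ with $\sigma(x)\le\sigma(y)$ whenever $x\preceq y$. A decreasing $\delta$-permutree is a pair $\mathcal T=(T,\sigma)$ with $T$ a $\delta$-permutree and $\sigma$ a linear extension of $V(T)$. In-order reading. $\mathcal I_\delta(T,\sigma)=\sigma\circ p^{-1}\in S_n$. By a theorem of Pilaud and Pons, $\mathcal I_\delta$ is a bijection from decreasing $\delta$-permutrees to $S_n$. If $\mathcal I_\delta(T,\sigma)=w$, then for $i<j$ the vertices $p^{-1}(i),p^{-1}(j)$ are $\preceq$-comparable if and only if they are not separated by a wall, i.e. there is no $k$ with $i<k<j$ such that [$\delta_k\in\{\mathsf u,\mathsf{ud}\}$ and $w(k)<\min\{w(i),w(j)\}$] or [$\delta_k\in\{\mathsf d,\mathsf{ud}\}$ and $w(k)>\max\{w(i),w(j)\}$]. Congruence and operator. Write $\mathrm{skel}_\delta(w)=T$ if $\mathcal I_\delta^{-1}(w)=(T,\sigma)$. The $\delta$-permutree congruence is $v\equiv_\delta w\iff\mathrm{skel}_\delta(v)=\mathrm{skel}_\delta(w)$ (same tree with same labeling $p$); by Pilaud and Pons it is a lattice congruence on the left weak order of $S_n$ ($x\le_L y\iff\ell(yx^{-1})=\ell(y)-\ell(x)$). Let $\pi_\downarrow^{\equiv_\delta}(w)$ be the $\le_L$-minimal element of the class of $w$. The permutree stack-sorting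 operator is $\mathbf S_{\equiv_\delta}(w)=w\,(\pi_\downarrow^{\equiv_\delta}(w))^{-1}$. Postorder reading. The postorder of $V(T)$ is the unique linear extension $\sigma_{\mathrm{post}}:V(T)\to[n]$ such that $\sigma_{\mathrm{post}}(x)<\sigma_{\mathrm{post}}(y)$ whenever $x,y$ are $\preceq$-incomparable and $p(x)<p(y)$. The postorder reading of a decreasing permutree $\mathcal T=(T,\sigma)$ is $\mathcal P(\mathcal T)=\sigma\circ\sigma_{\mathrm{post}}^{-1}\in S_n$. *)

theory Defs
  imports "HOL-Library.FuncSet" "HOL-Combinatorics.Permutations"
begin

section \<open>Decorations and permutrees\<close>

datatype decoration = NoWall | UpWall | DownWall | BothWalls

text \<open>The letters of a decoration word are numbered from 1.\<close>

abbreviation decoration_at :: "decoration list \<Rightarrow> nat \<Rightarrow> decoration" where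
  "decoration_at \<delta> k \<equiv> \<delta> ! (k - 1)"

text \<open>
  A pair \<open>(v, u)\<close> in \<open>arrows T\<close> is the arrow from \<open>v\<close> to its parent \<open>u\<close>. There is no separate
  field for the planar embedding: a permutree is drawn with each vertex \<open>v\<close> at abscissa
  \<open>label T v\<close>, so the labelling already fixes the embedding.
\<close>

record 'v labelled_digraph =
  verts :: "'v set"
  arrows :: "('v \<times> 'v) set"
  label :: "'v \<Rightarrow> nat"

definition parents :: "('v, 'z) labelled_digraph_scheme \<Rightarrow> 'v \<Rightarrow> 'v set" where
  "parents T v = {u. (v, u) \<in> arrows T}"

definition children :: "('v, 'z) labelled_digraph_scheme \<Rightarrow> 'v \<Rightarrow> 'v set" where
  "children T v = {u. (u, v) \<in> arrows T}"

definition ancestors :: "('v, 'z) labelled_digraph_scheme \<Rightarrow> 'v \<Rightarrow> 'v set" where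
  "ancestors T v = {u. (v, u) \<in> (arrows T)\<^sup>+}"

definition descendants :: "('v, 'z) labelled_digraph_scheme \<Rightarrow> 'v \<Rightarrow> 'v set" where
  "descendants T v = {u. (u, v) \<in> (arrows T)\<^sup>+}"

definition tree_le :: "('v, 'z) labelled_digraph_scheme \<Rightarrow> 'v \<Rightarrow> 'v \<Rightarrow> bool" where
  "tree_le T u v \<longleftrightarrow> (u, v) \<in> (arrows T)\<^sup>*"

text \<open>
  A directed tree is an orientation of an undirected tree: at most one arrow between two vertices
  (whence \<open>irrefl\<close> and \<open>antisym\<close>), and the underlying undirected graph, whose adjacency relation
  is \<open>edges T\<close>, is connected and has no cycle. The digraph with no vertices is admitted; it is the
  only permutree for the empty decoration.
\<close>

definition edges :: "('v, 'z) labelled_digraph_scheme \<Rightarrow> ('v \<times> 'v) set" where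
  "edges T = arrows T \<union> (arrows T)\<inverse>"

definition undirected_cycle :: "('v, 'z) labelled_digraph_scheme \<Rightarrow> 'v list \<Rightarrow> bool" where
  "undirected_cycle T c \<longleftrightarrow> 3 \<le> length c \<and> distinct c \<and>
     (\<forall>i. Suc i < length c \<longrightarrow> (c ! i, c ! Suc i) \<in> edges T) \<and> (last c, hd c) \<in> edges T"

definition directed_tree :: "('v, 'z) labelled_digraph_scheme \<Rightarrow> bool" where
  "directed_tree T \<longleftrightarrow> finite (verts T) \<and> arrows T \<subseteq> verts T \<times> verts T \<and>
     irrefl (arrows T) \<and> antisym (arrows T) \<and>
     (\<forall>u\<in>verts T. \<forall>v\<in>verts T. (u, v) \<in> (edges T)\<^sup>*) \<and>
     (\<nexists>c. undirected_cycle T c)"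

definition permutree :: "decoration list \<Rightarrow> ('v, 'z) labelled_digraph_scheme \<Rightarrow> bool" where
  "permutree \<delta> T \<longleftrightarrow> directed_tree T \<and>
     bij_betw (label T) (verts T) {1..length \<delta>} \<and>
     (\<forall>v\<in>verts T.
       (decoration_at \<delta> (label T v) \<in> {NoWall, DownWall} \<longrightarrow>
          (\<exists>\<^sub>\<le>\<^sub>1u. u \<in> parents T v)) \<and>
       (decoration_at \<delta> (label T v) \<in> {NoWall, UpWall} \<longrightarrow>
          (\<exists>\<^sub>\<le>\<^sub>1u. u \<in> children T v)) \<and>
       (decoration_at \<delta> (label T v) \<in> {UpWall, BothWalls} \<longrightarrow>
          (\<exists>\<^sub>\<le>\<^sub>1u. u \<in> parents T v \<and> label T u < label T v) \<and>
          (\<forall>u\<in>parents T v. label T u < label T v \<longrightarrow>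
             (\<forall>u'\<in>ancestors T u. label T u' < label T v)) \<and>
          (\<exists>\<^sub>\<le>\<^sub>1u. u \<in> parents T v \<and> label T u > label T v) \<and>
          (\<forall>u\<in>parents T v. label T u > label T v \<longrightarrow>
             (\<forall>u'\<in>ancestors T u. label T u' > label T v))) \<and>
       (decoration_at \<delta> (label T v) \<in> {DownWall, BothWalls} \<longrightarrow>
          (\<exists>\<^sub>\<le>\<^sub>1u. u \<in> children T v \<and> label T u < label T v) \<and>
          (\<forall>u\<in>children T v. label T u < label T v \<longrightarrow>
             (\<forall>u'\<in>descendants T u. label T u' < label T v)) \<and>
          (\<exists>\<^sub>\<le>\<^sub>1u. u \<in> children T v \<and> label T u > label T v) \<and>
          (\<forall>u\<in>children T v. label T u > label T v \<longrightarrow>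
             (\<forall>u'\<in>descendants T u. label T u' > label T v))))"

text \<open>
  Linear extensions are functions on \<open>verts T\<close> only; \<open>extensional\<close> fixes their values elsewhere,
  so that distinct HOL functions are distinct linear extensions.
\<close>

definition linear_extension :: "('v, 'z) labelled_digraph_scheme \<Rightarrow> ('v \<Rightarrow> nat) \<Rightarrow> bool" where
  "linear_extension T \<sigma> \<longleftrightarrow> \<sigma> \<in> extensional (verts T) \<and>
     bij_betw \<sigma> (verts T) {1..card (verts T)} \<and>
     (\<forall>x\<in>verts T. \<forall>y\<in>verts T. tree_le T x y \<longrightarrow> \<sigma> x \<le> \<sigma> y)"

definition decreasing_permutrees ::
  "decoration list \<Rightarrow> ('v labelled_digraph \<times> ('v \<Rightarrow> nat)) set" where
  "decreasing_permutrees \<delta> = {(T, \<sigma>). permutree \<delta> T \<and> linear_extension T \<sigma>}"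

text \<open>Equality of labelled trees, the names of the vertices being immaterial.\<close>

definition same_labelled_tree ::
  "('v, 'z) labelled_digraph_scheme \<Rightarrow> ('w, 'y) labelled_digraph_scheme \<Rightarrow> bool" where
  "same_labelled_tree T T' \<longleftrightarrow> (\<exists>f. bij_betw f (verts T) (verts T') \<and>
     (\<forall>u\<in>verts T. \<forall>v\<in>verts T. (u, v) \<in> arrows T \<longleftrightarrow> (f u, f v) \<in> arrows T') \<and>
     (\<forall>v\<in>verts T. label T' (f v) = label T v))"


section \<open>In-order and postorder readings\<close>

text \<open>
  Elements of the symmetric group are functions \<open>w\<close> with \<open>w permutes {1..n}\<close>, hence the identity
  outside \<open>{1..n}\<close>. Products are composed from right to left.
\<close>

fun in_order_reading :: "'v labelled_digraph \<times> ('v \<Rightarrow> nat) \<Rightarrow> nat \<Rightarrow> nat" where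
  "in_order_reading (T, \<sigma>) = (\<lambda>i. if i \<in> {1..card (verts T)}
     then (\<sigma> \<circ> inv_into (verts T) (label T)) i else i)"

text \<open>
  The in-order reading determines a decreasing permutree up to renaming of the vertices, so a
  representative with vertices in \<^typ>\<open>nat\<close> is chosen. Neither \<open>same_labelled_tree\<close> nor
  \<open>postorder_reading\<close> depends on the choice.
\<close>

definition in_order_inv ::
  "decoration list \<Rightarrow> (nat \<Rightarrow> nat) \<Rightarrow> nat labelled_digraph \<times> (nat \<Rightarrow> nat)" where
  "in_order_inv \<delta> = inv_into (decreasing_permutrees \<delta>) in_order_reading"

definition postorder :: "('v, 'z) labelled_digraph_scheme \<Rightarrow> 'v \<Rightarrow> nat" where
  "postorder T = (THE \<sigma>. linear_extension T \<sigma> \<and>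
     (\<forall>x\<in>verts T. \<forall>y\<in>verts T.
        \<not> tree_le T x y \<and> \<not> tree_le T y x \<and> label T x < label T y \<longrightarrow> \<sigma> x < \<sigma> y))"

fun postorder_reading :: "'v labelled_digraph \<times> ('v \<Rightarrow> nat) \<Rightarrow> nat \<Rightarrow> nat" where
  "postorder_reading (T, \<sigma>) = (\<lambda>i. if i \<in> {1..card (verts T)}
     then (\<sigma> \<circ> inv_into (verts T) (postorder T)) i else i)"


section \<open>The permutree congruence and the stack-sorting operator\<close>

definition skel :: "decoration list \<Rightarrow> (nat \<Rightarrow> nat) \<Rightarrow> nat labelled_digraph" where
  "skel \<delta> w = fst (in_order_inv \<delta> w)"

definition permutree_congruent ::
  "decoration list \<Rightarrow> (nat \<Rightarrow> nat) \<Rightarrow> (nat \<Rightarrow> nat) \<Rightarrow> bool" where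
  "permutree_congruent \<delta> v w \<longleftrightarrow> same_labelled_tree (skel \<delta> v) (skel \<delta> w)"

text \<open>The Coxeter length, as the number of inversions.\<close>

definition perm_length :: "nat \<Rightarrow> (nat \<Rightarrow> nat) \<Rightarrow> nat" where
  "perm_length n w = card {(i, j). i \<in> {1..n} \<and> j \<in> {1..n} \<and> i < j \<and> w i > w j}"

definition left_weak_le :: "nat \<Rightarrow> (nat \<Rightarrow> nat) \<Rightarrow> (nat \<Rightarrow> nat) \<Rightarrow> bool" where
  "left_weak_le n x y \<longleftrightarrow>
     int (perm_length n (y \<circ> inv x)) = int (perm_length n y) - int (perm_length n x)"

definition permutree_class :: "decoration list \<Rightarrow> (nat \<Rightarrow> nat) \<Rightarrow> (nat \<Rightarrow> nat) set" where
  "permutree_class \<delta> w = {v. v permutes {1..length \<delta>} \<and> permutree_congruent \<delta> v w}"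

definition pi_down :: "decoration list \<Rightarrow> (nat \<Rightarrow> nat) \<Rightarrow> (nat \<Rightarrow> nat)" where
  "pi_down \<delta> w = (THE x. x \<in> permutree_class \<delta> w \<and>
     (\<forall>y\<in>permutree_class \<delta> w. left_weak_le (length \<delta>) y x \<longrightarrow> y = x))"

definition permutree_stack_sort :: "decoration list \<Rightarrow> (nat \<Rightarrow> nat) \<Rightarrow> (nat \<Rightarrow> nat)" where
  "permutree_stack_sort \<delta> w = w \<circ> inv (pi_down \<delta> w)"

end

theory Submission
  imports Defs
begin

text \<open>
  Walk along the tree without backtracking. A turn at \<open>t\<close> uses two parents or two children of
  \<open>t\<close>, so there is a wall at \<open>t\<close>, and the walk leaves \<open>t\<close> on the other side of that wall. Hence the
  turning vertices between two vertices have monotone labels. This has two consequences. If an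
  arrow \<open>i \<rightarrow> j\<close> passes over the label of \<open>k\<close>, then \<open>k\<close> is below \<open>i\<close> or above \<open>j\<close>. Two incomparable
  vertices are separated by the wall of a vertex that is comparable to the first of them.

  From the first consequence, the relation ``below, or incomparable with smaller label'' is
  transitive. So the postorder exists. Its only inversions are those which all linear extensions
  share, so it is the least element of the set of linear extensions in the left weak order. With
  the second consequence, the arrows can be recovered from the in-order reading, so this set of
  linear extensions is the congruence class.
\<close>

section \<open>Walks in digraphs with walls\<close>

text \<open>The local permutree conditions, in a form closed under two symmetries: \<open>p\<close>
  takes integer values so that negation reflects left and right, and \<open>up\<close> and
  \<open>down\<close> are separate predicates so that reversing the arrows exchanges them.\<close>

locale walled_digraph =
  fixes A :: "('v \<times> 'v) set" and p :: "'v \<Rightarrow> int" and up down :: "'v \<Rightarrow> bool"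
  assumes parents_branch: "\<lbrakk>(v, u) \<in> A; (v, u') \<in> A; u \<noteq> u'\<rbrakk> \<Longrightarrow>
      up v \<and> (p u < p v \<and> p v < p u' \<or> p u' < p v \<and> p v < p u)"
    and ancestors_side: "\<lbrakk>up v; (v, u) \<in> A; (u, x) \<in> A\<^sup>*\<rbrakk> \<Longrightarrow>
      p u < p v \<and> p x < p v \<or> p v < p u \<and> p v < p x"
    and children_branch: "\<lbrakk>(u, v) \<in> A; (u', v) \<in> A; u \<noteq> u'\<rbrakk> \<Longrightarrow>
      down v \<and> (p u < p v \<and> p v < p u' \<or> p u' < p v \<and> p v < p u)"
    and descendants_side: "\<lbrakk>down v; (u, v) \<in> A; (x, u) \<in> A\<^sup>*\<rbrakk> \<Longrightarrow>
      p u < p v \<and> p x < p v \<or> p v < p u \<and> p v < p x"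
begin

lemma mirror: "walled_digraph A (\<lambda>v. - p v) up down"
  apply unfold_locales
  subgoal using parents_branch by fastforce
  subgoal using ancestors_side by fastforce
  subgoal using children_branch by fastforce
  subgoal using descendants_side by fastforce
  done

lemma dual: "walled_digraph (A\<inverse>) p down up"
  apply unfold_locales
  subgoal using children_branch by simp
  subgoal using descendants_side by (simp add: rtrancl_converse)
  subgoal using parents_branch by simp
  subgoal using ancestors_side by (simp add: rtrancl_converse)
  done

end

text \<open>
  \<open>nb_walk E x x1 y' y\<close>: a walk without immediate backtracking, with first step \<open>(x, x1)\<close> and
  last step \<open>(y', y)\<close>.
\<close>

inductive nb_walk :: "('v \<times> 'v) set \<Rightarrow> 'v \<Rightarrow> 'v \<Rightarrow> 'v \<Rightarrow> 'v \<Rightarrow> bool" for E where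
  first: "(x, y) \<in> E \<Longrightarrow> nb_walk E x y x y"
| step: "\<lbrakk>nb_walk E x x1 y' y; (y, z) \<in> E; z \<noteq> y'\<rbrakk> \<Longrightarrow> nb_walk E x x1 y z"

lemma nb_walk_exists:
  assumes "(x, y) \<in> E\<^sup>*"
  shows "x = y \<or> (\<exists>x1 y'. nb_walk E x x1 y' y)"
  using assms
proof (induction rule: rtrancl_induct)
  case (step y z)
  show ?case
  proof (cases "x = y")
    case True
    then show ?thesis using step.hyps nb_walk.first by metis
  next
    case False
    then obtain x1 y' where walk: "nb_walk E x x1 y' y" using step.IH by blast
    show ?thesis
    proof (cases "z = y'")
      case True
      \<comment> \<open>A backtracking step cancels the last one: either the walk returns to
        \<open>x\<close>, or its part before that step already ends at \<open>y'\<close>.\<close>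
      from walk show ?thesis unfolding True by cases auto
    next
      case False
      then show ?thesis using walk step.hyps nb_walk.step by metis
    qed
  qed
qed simp

lemma nb_walk_prepend:
  assumes "nb_walk E x x1 y' y" "(z, x) \<in> E" "z \<noteq> x1"
  shows "nb_walk E z x y' y"
  using assms by (induction rule: nb_walk.induct) (metis nb_walk.first nb_walk.step)+

text \<open>
  The situation of a walk whose last step is \<open>(y', y)\<close>: its last turn was at \<open>t\<close>, and since then
  it has been going up, on the right of the wall above \<open>t\<close>.
\<close>

definition right_ascent ::
  "('v \<times> 'v) set \<Rightarrow> ('v \<Rightarrow> int) \<Rightarrow> ('v \<Rightarrow> bool) \<Rightarrow> 'v \<Rightarrow> 'v \<Rightarrow> 'v \<Rightarrow> bool" where
  "right_ascent A p up t y' y \<longleftrightarrow> up t \<and> (t, y') \<in> A\<^sup>* \<and> (y', y) \<in> A \<and>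
     (\<exists>u. (t, u) \<in> A \<and> (u, y) \<in> A\<^sup>* \<and> p t < p u)"

text \<open>Covers ascents and descents after the last turn. The lower bound \<open>a\<close> stays
  fixed while the turning vertex \<open>t\<close> moves to the right.\<close>

definition right_of ::
  "('v \<times> 'v) set \<Rightarrow> ('v \<Rightarrow> int) \<Rightarrow> ('v \<Rightarrow> bool) \<Rightarrow> ('v \<Rightarrow> bool) \<Rightarrow> int \<Rightarrow> 'v \<Rightarrow> 'v \<Rightarrow> bool" where
  "right_of A p up down a y' y \<longleftrightarrow>
     (\<exists>t. a \<le> p t \<and> (right_ascent A p up t y' y \<or> right_ascent (A\<inverse>) p down t y' y))"

context walled_digraph
begin

lemma right_ascent_less: "right_ascent A p up t y' y \<Longrightarrow> p t < p y"
  unfolding right_ascent_def using ancestors_side by fastforce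

text \<open>Going further up keeps the ascent. Turning down at \<open>y\<close> uses two children of
  \<open>y\<close>, so there is a wall below \<open>y\<close>; both \<open>t\<close> and
  \<open>y'\<close> are on its left, so \<open>z\<close> is on its right, and \<open>y\<close> is
  the new turning vertex.\<close>

lemma right_ascent_step:
  assumes asc: "right_ascent A p up t y' y" and edge: "(y, z) \<in> A \<union> A\<inverse>" and ne: "z \<noteq> y'"
  shows "right_of A p up down (p t) y z"
proof (cases "(y, z) \<in> A")
  case True
  then have "right_ascent A p up t y z"
    using asc unfolding right_ascent_def by (meson rtrancl.rtrancl_into_rtrancl)
  then show ?thesis unfolding right_of_def by blast
next
  case False
  then have zy: "(z, y) \<in> A" using edge by auto
  have y'y: "(y', y) \<in> A" and ty': "(t, y') \<in> A\<^sup>*" using asc by (auto simp: right_ascent_def)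
  have "p t < p y" using asc by (rule right_ascent_less)
  moreover have branch: "down y" "p y' < p y \<and> p y < p z \<or> p z < p y \<and> p y < p y'"
    using children_branch[OF y'y zy] ne by auto
  ultimately have "p y < p z" using descendants_side[OF branch(1) y'y ty'] by auto
  then have "right_ascent (A\<inverse>) p down y y z"
    using branch zy by (auto simp: right_ascent_def)
  then show ?thesis unfolding right_of_def using \<open>p t < p y\<close> less_imp_le by blast
qed

lemma right_of_less: "right_of A p up down a y' y \<Longrightarrow> a < p y"
  unfolding right_of_def
  using right_ascent_less walled_digraph.right_ascent_less[OF dual] by force

lemma right_of_dual: "right_of (A\<inverse>) p down up a y' y \<longleftrightarrow> right_of A p up down a y' y"
  unfolding right_of_def by auto

lemma right_of_step:
  assumes "right_of A p up down a y' y" "(y, z) \<in> A \<union> A\<inverse>" "z \<noteq> y'"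
  shows "right_of A p up down a y z"
proof -
  obtain t where t: "a \<le> p t"
    and "right_ascent A p up t y' y \<or> right_ascent (A\<inverse>) p down t y' y"
    using assms(1) unfolding right_of_def by blast
  then have "right_of A p up down (p t) y z"
    using right_ascent_step walled_digraph.right_ascent_step[OF dual] assms(2,3)
    by (auto simp: right_of_dual)
  then show ?thesis using t order_trans unfolding right_of_def by meson
qed

text \<open>The first turn of a walk that went straight up; it starts the invariant that
  \<open>right_of_step\<close> preserves.\<close>

lemma turn_right:
  assumes "(y', y) \<in> A" "(z, y) \<in> A" "z \<noteq> y'" "p y' < p y"
  shows "down y" "right_of A p up down (p y) y z"
proof -
  show d: "down y" using children_branch[OF assms(1,2)] assms(3) by auto
  have "p y < p z" using children_branch[OF assms(1,2)] assms(3,4) by auto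
  then have "right_ascent (A\<inverse>) p down y y z" using d assms(2) by (auto simp: right_ascent_def)
  then show "right_of A p up down (p y) y z" unfolding right_of_def by force
qed

text \<open>Either the walk has gone straight up so far, or \<open>t\<close> is its first turning
  vertex and \<open>right_of\<close>, possibly for the reflected labels, has held since. As
  \<open>x1\<close> may be \<open>t\<close> itself, its inequalities are weak.\<close>

lemma walk_invariant:
  assumes "nb_walk (A \<union> A\<inverse>) x x1 y' y" "(x, x1) \<in> A"
  shows "(x, y') \<in> A\<^sup>* \<and> (y', y) \<in> A \<and> (x1, y) \<in> A\<^sup>* \<and> (y = x1 \<or> (x1, y') \<in> A\<^sup>*) \<or>
    (\<exists>t. down t \<and> (x, t) \<in> A\<^sup>+ \<and>
      (p x < p t \<and> p x1 \<le> p t \<and> right_of A p up down (p t) y' y \<or>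
       p t < p x \<and> p t \<le> p x1 \<and> right_of A (\<lambda>v. - p v) up down (- p t) y' y))"
  using assms
proof (induction rule: nb_walk.induct)
  case (first x y)
  then show ?case by auto
next
  case (step x x1 y' y z)
  interpret mirror: walled_digraph A "\<lambda>v. - p v" up down by (rule mirror)
  from step.IH[OF step.prems] show ?case
  proof (elim disjE)
    assume straight: "(x, y') \<in> A\<^sup>* \<and> (y', y) \<in> A \<and> (x1, y) \<in> A\<^sup>* \<and> (y = x1 \<or> (x1, y') \<in> A\<^sup>*)"
    show ?case
    proof (cases "(y, z) \<in> A")
      case True
      then show ?thesis using straight by (auto intro: rtrancl_into_rtrancl)
    next
      case False
      then have zy: "(z, y) \<in> A" using step.hyps by auto
      have xy: "(x, y) \<in> A\<^sup>+" and y'y: "(y', y) \<in> A" using straight by auto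
      \<comment> \<open>The walk enters \<open>y\<close> from one child and leaves to another. Both
        \<open>x\<close> and \<open>x1\<close>, unless \<open>x1\<close> is \<open>y\<close>, lie
        weakly below \<open>y'\<close>, hence on its side of the wall below
        \<open>y\<close>.\<close>
      have "down y" using children_branch[OF y'y zy] step.hyps by auto
      then have "p y' < p y \<and> p x < p y \<and> p x1 \<le> p y \<or> p y < p y' \<and> p y < p x \<and> p y \<le> p x1"
        using straight descendants_side[OF _ y'y, of x] descendants_side[OF _ y'y, of x1]
        by fastforce
      then show ?thesis
        using turn_right[OF y'y zy] mirror.turn_right[OF y'y zy] step.hyps xy by auto
    qed
  next
    assume "\<exists>t. down t \<and> (x, t) \<in> A\<^sup>+ \<and>
      (p x < p t \<and> p x1 \<le> p t \<and> right_of A p up down (p t) y' y \<or>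
       p t < p x \<and> p t \<le> p x1 \<and> right_of A (\<lambda>v. - p v) up down (- p t) y' y)"
    then show ?case
      using right_of_step[OF _ step.hyps(2,3)] mirror.right_of_step[OF _ step.hyps(2,3)] by blast
  qed
qed

text \<open>
  At every turn of a walk without backtracking, the wall at the turning vertex forces the walk to
  continue on the other side of that vertex. So the labels of the turning vertices are monotone.
\<close>

lemma walk_up:
  assumes "nb_walk (A \<union> A\<inverse>) x x1 y' y" "(x, x1) \<in> A"
  shows "(x1, y) \<in> A\<^sup>* \<or> (\<exists>t. down t \<and> (x, t) \<in> A\<^sup>+ \<and>
    (p x < p t \<and> p x1 \<le> p t \<and> p t < p y \<or> p t < p x \<and> p t \<le> p x1 \<and> p y < p t))"
  using walk_invariant[OF assms] right_of_less walled_digraph.right_of_less[OF mirror] by fastforce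

lemma walk_down:
  assumes "nb_walk (A \<union> A\<inverse>) x x1 y' y" "(x1, x) \<in> A"
  shows "(y, x1) \<in> A\<^sup>* \<or> (\<exists>t. up t \<and> (t, x) \<in> A\<^sup>+ \<and>
    (p x < p t \<and> p x1 \<le> p t \<and> p t < p y \<or> p t < p x \<and> p t \<le> p x1 \<and> p y < p t))"
  using walled_digraph.walk_up[OF dual, of x x1 y' y] assms
  by (simp add: rtrancl_converse trancl_converse Un_commute)

section \<open>Consequences of the monotone turning labels\<close>

lemma nb_walk_first_edge: "nb_walk (A \<union> A\<inverse>) x x1 y' y \<Longrightarrow> (x, x1) \<in> A \<or> (x1, x) \<in> A"
  by (induction rule: nb_walk.induct) auto

text \<open>Without a turn, the walk would be a directed cycle; with one, its first turning vertex
  would lie strictly between its two equal ends.\<close>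

lemma no_closed_walk:
  assumes "acyclic A"
  shows "\<not> nb_walk (A \<union> A\<inverse>) x x1 y' x"
proof
  assume walk: "nb_walk (A \<union> A\<inverse>) x x1 y' x"
  from nb_walk_first_edge[OF walk] show False
  proof
    assume "(x, x1) \<in> A"
    then show False using walk_up[OF walk] assms
      by (auto simp: acyclic_def dest: rtrancl_into_trancl2)
  next
    assume "(x1, x) \<in> A"
    then show False using walk_down[OF walk] assms
      by (auto simp: acyclic_def dest: rtrancl_into_trancl1)
  qed
qed

text \<open>The path through \<open>c\<close> would give \<open>i\<close> a second parent
  \<open>d\<close>. The wall above \<open>i\<close> separates \<open>d\<close> from
  \<open>j\<close>, but \<open>j\<close> is an ancestor of \<open>d\<close> and must be on its
  side.\<close>

lemma edge_covers:
  assumes "acyclic A" "(i, j) \<in> A" "(i, c) \<in> A\<^sup>+" "(c, j) \<in> A\<^sup>+"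
  shows False
proof -
  obtain d where d: "(i, d) \<in> A" "(d, c) \<in> A\<^sup>*" using assms(3) by (meson tranclD)
  then have dj: "(d, j) \<in> A\<^sup>+" using assms(4) by simp
  then have "d \<noteq> j" using assms(1) by (auto simp: acyclic_def)
  then show False
    using parents_branch[OF d(1) assms(2)] ancestors_side[OF _ d(1) trancl_into_rtrancl[OF dj]]
    by auto
qed

text \<open>
  Follow the walk from \<open>i\<close> to \<open>k\<close>, or from \<open>j\<close> to \<open>k\<close> if the former does not use the arrow: a
  first turn would have to lie beyond both ends of the arrow.
\<close>

lemma between_arrow:
  assumes "(i, j) \<in> A" "(i, k) \<in> (A \<union> A\<inverse>)\<^sup>*"
    and "p i < p k \<and> p k < p j \<or> p j < p k \<and> p k < p i"
  shows "(k, i) \<in> A\<^sup>+ \<or> (j, k) \<in> A\<^sup>+"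
proof -
  have ne: "k \<noteq> i" "k \<noteq> j" using assms(3) by auto
  then obtain x1 y' where walk: "nb_walk (A \<union> A\<inverse>) i x1 y' k"
    using nb_walk_exists[OF assms(2)] by auto
  show ?thesis
  proof (cases "x1 = j")
    case True
    then have "(j, k) \<in> A\<^sup>*" using walk_up[of i j y' k] walk assms(1,3) by fastforce
    then show ?thesis using ne by (auto simp: rtrancl_eq_or_trancl)
  next
    case False
    then have "nb_walk (A \<union> A\<inverse>) j i y' k" using nb_walk_prepend[OF walk, of j] assms(1) by auto
    then have "(k, i) \<in> A\<^sup>*" using walk_down[of j i y' k] assms(1,3) by fastforce
    then show ?thesis using ne by (auto simp: rtrancl_eq_or_trancl)
  qed
qed

text \<open>The walk from \<open>x\<close> to \<open>y\<close> has to turn. Its first turning vertex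
  is reached by a directed path, so it is comparable to \<open>x\<close>, and by monotonicity its
  label lies between the two.\<close>

lemma incomparable_separated:
  assumes "(x, y) \<in> (A \<union> A\<inverse>)\<^sup>*" "(x, y) \<notin> A\<^sup>*" "(y, x) \<notin> A\<^sup>*"
  shows "\<exists>t. (p x < p t \<and> p t < p y \<or> p y < p t \<and> p t < p x) \<and>
    (down t \<and> (x, t) \<in> A\<^sup>+ \<or> up t \<and> (t, x) \<in> A\<^sup>+)"
proof -
  obtain x1 y' where walk: "nb_walk (A \<union> A\<inverse>) x x1 y' y"
    using nb_walk_exists[OF assms(1)] assms(2) by auto
  from nb_walk_first_edge[OF walk] show ?thesis
  proof
    assume e: "(x, x1) \<in> A"
    then have "(x1, y) \<notin> A\<^sup>*" using assms(2) by (meson converse_rtrancl_into_rtrancl)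
    then show ?thesis using walk_up[OF walk e] by blast
  next
    assume e: "(x1, x) \<in> A"
    then have "(y, x1) \<notin> A\<^sup>*" using assms(3) by (meson rtrancl.rtrancl_into_rtrancl)
    then show ?thesis using walk_down[OF walk e] by blast
  qed
qed

end

section \<open>The postorder\<close>

text \<open>The function \<open>s\<close> plays the role of a linear extension. Its strict growth
  along arrows gives acyclicity, and later it orients comparable vertices.\<close>

locale permutree_poset = walled_digraph A p up down
  for A :: "('v \<times> 'v) set" and p :: "'v \<Rightarrow> int" and up down :: "'v \<Rightarrow> bool" +
  fixes V :: "'v set" and s :: "'v \<Rightarrow> nat"
  assumes finite_V: "finite V"
    and arrows_sub: "A \<subseteq> V \<times> V"
    and connected: "\<lbrakk>x \<in> V; y \<in> V\<rbrakk> \<Longrightarrow> (x, y) \<in> (A \<union> A\<inverse>)\<^sup>*"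
    and inj_p: "inj_on p V"
    and s_less: "(x, y) \<in> A \<Longrightarrow> s x < s y"
begin

lemma trancl_s_less: "(x, y) \<in> A\<^sup>+ \<Longrightarrow> s x < s y"
  by (induction rule: trancl_induct) (auto dest: s_less)

lemma acyclic: "acyclic A"
  unfolding acyclic_def using trancl_s_less by blast

lemma trancl_in_V: "(x, y) \<in> A\<^sup>+ \<Longrightarrow> x \<in> V \<and> y \<in> V"
  using trancl_subset_Sigma[OF arrows_sub] by blast

text \<open>Extends \<open>between_arrow\<close> to paths whose end has a smaller label than their
  start: either such a path meets \<open>b\<close>, or one of its arrows passes over the label of
  \<open>b\<close>.\<close>

lemma between_path:
  assumes "(c, a) \<in> A\<^sup>+" "b \<in> V" "p a < p b" "p b < p c"
  shows "(b, a) \<in> A\<^sup>+ \<or> (c, b) \<in> A\<^sup>+"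
  using assms
proof (induction rule: trancl_induct)
  case (base a)
  then have "(c, b) \<in> (A \<union> A\<inverse>)\<^sup>*" using connected arrows_sub by auto
  then have "(b, c) \<in> A\<^sup>+ \<or> (a, b) \<in> A\<^sup>+" using between_arrow[OF base.hyps] base.prems by auto
  then show ?case
    using base.hyps by (meson trancl.trancl_into_trancl trancl_into_trancl2)
next
  case (step y a)
  consider "p b < p y" | "p y = p b" | "p y < p b" by linarith
  then show ?case
  proof cases
    case 1
    then have "(y, b) \<in> (A \<union> A\<inverse>)\<^sup>*" using connected arrows_sub step by auto
    then have "(b, y) \<in> A\<^sup>+ \<or> (a, b) \<in> A\<^sup>+"
      using between_arrow[OF step.hyps(2)] step.prems 1 by auto
    then show ?thesis using step.hyps by (meson trancl.trancl_into_trancl trancl_trans)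
  next
    case 2
    then have "y = b" using inj_p step arrows_sub by (auto dest: inj_onD)
    then show ?thesis using step.hyps by simp
  next
    case 3
    then show ?thesis using step by (meson trancl.trancl_into_trancl)
  qed
qed

text \<open>The strict linear order in which the postorder lists the vertices; its rank function
  will be the postorder.\<close>

definition before :: "'v \<Rightarrow> 'v \<Rightarrow> bool" where
  "before x y \<longleftrightarrow> (x, y) \<in> A\<^sup>+ \<or> (y, x) \<notin> A\<^sup>+ \<and> p x < p y"

lemma before_irrefl: "\<not> before x x"
  using acyclic by (auto simp: before_def acyclic_def)

lemma before_total: "\<lbrakk>x \<in> V; y \<in> V; x \<noteq> y\<rbrakk> \<Longrightarrow> before x y \<or> before y x"
  unfolding before_def using inj_p by (metis inj_onD linorder_neqE)

text \<open>In a mixed case, a failure would need \<open>p z < p x\<close>; then the given path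
  passes over the label of the third vertex, and \<open>between_path\<close> yields the desired path
  from \<open>x\<close> to \<open>z\<close>. If neither hypothesis is a path, a path from
  \<open>z\<close> to \<open>x\<close> would pass over \<open>y\<close>.\<close>

lemma before_trans:
  assumes V: "x \<in> V" "y \<in> V" "z \<in> V" and xy: "before x y" and yz: "before y z"
  shows "before x z"
proof -
  have antisym: "\<not> ((a, b) \<in> A\<^sup>+ \<and> (b, a) \<in> A\<^sup>+)" for a b
    using trancl_s_less by (meson order.asym)
  have ne: "p x \<noteq> p z" if "x \<noteq> z" using that V inj_p by (auto dest: inj_onD)
  have "x \<noteq> z" using xy yz antisym unfolding before_def by auto
  then have ne: "p x < p z \<or> p z < p x" using ne by auto
  consider "(x, y) \<in> A\<^sup>+" "(y, z) \<in> A\<^sup>+"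
    | "(x, y) \<in> A\<^sup>+" "(z, y) \<notin> A\<^sup>+" "p y < p z"
    | "(y, x) \<notin> A\<^sup>+" "p x < p y" "(y, z) \<in> A\<^sup>+"
    | "(y, x) \<notin> A\<^sup>+" "p x < p y" "(z, y) \<notin> A\<^sup>+" "p y < p z"
    using xy yz unfolding before_def by blast
  then show ?thesis
  proof cases
    case 1
    then show ?thesis unfolding before_def by (meson trancl_trans)
  next
    case 2
    then have "(z, x) \<notin> A\<^sup>+" by (meson trancl_trans)
    then show ?thesis using 2 between_path[OF 2(1) V(3)] ne unfolding before_def by auto
  next
    case 3
    then have "(z, x) \<notin> A\<^sup>+" by (meson trancl_trans)
    then show ?thesis using 3 between_path[OF 3(3) V(1)] ne unfolding before_def by auto
  next
    case 4
    then have "(z, x) \<notin> A\<^sup>+" using between_path[of z x y] V by auto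
    then show ?thesis using 4 unfolding before_def by auto
  qed
qed

end

section \<open>Ranks in finite linear orders\<close>

lemma bij_betw_rank:
  fixes R :: "'v \<Rightarrow> 'v \<Rightarrow> bool"
  assumes fin: "finite V"
    and irr: "\<And>x. \<not> R x x"
    and tot: "\<And>x y. \<lbrakk>x \<in> V; y \<in> V; x \<noteq> y\<rbrakk> \<Longrightarrow> R x y \<or> R y x"
    and trans: "\<And>x y z. \<lbrakk>x \<in> V; y \<in> V; z \<in> V; R x y; R y z\<rbrakk> \<Longrightarrow> R x z"
  defines "r \<equiv> \<lambda>x. card {y \<in> V. y = x \<or> R y x}"
  shows "bij_betw r V {1..card V}" "\<And>x y. \<lbrakk>x \<in> V; y \<in> V; R x y\<rbrakk> \<Longrightarrow> r x < r y"
proof -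
  show mono: "r x < r y" if "x \<in> V" "y \<in> V" "R x y" for x y
    unfolding r_def
  proof (rule psubset_card_mono)
    have "y \<notin> {z \<in> V. z = x \<or> R z x}" using that irr trans by blast
    moreover have "{z \<in> V. z = x \<or> R z x} \<subseteq> {z \<in> V. z = y \<or> R z y}" using that trans by blast
    ultimately show "{z \<in> V. z = x \<or> R z x} \<subset> {z \<in> V. z = y \<or> R z y}" using that by blast
  qed (use fin in simp)
  then have inj: "inj_on r V" by (metis inj_onI less_irrefl tot)
  have "r ` V \<subseteq> {1..card V}"
  proof
    fix k assume "k \<in> r ` V"
    then obtain x where x: "x \<in> V" "k = r x" by auto
    \<comment> \<open>The rank of \<open>x\<close> counts \<open>x\<close> itself, so ranks start at
      1.\<close>
    have "0 < r x" unfolding r_def using fin x by (auto simp: card_gt_0_iff)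
    moreover have "r x \<le> card V" unfolding r_def using fin by (auto intro: card_mono)
    ultimately show "k \<in> {1..card V}" using x by auto
  qed
  then have "r ` V = {1..card V}" using inj fin by (intro card_subset_eq) (auto simp: card_image)
  then show "bij_betw r V {1..card V}" using inj by (simp add: bij_betw_def)
qed

text \<open>Used to show that a linear extension or a permutation is determined by the comparisons
  between its values.\<close>

lemma rank_eq:
  fixes f :: "'v \<Rightarrow> nat"
  assumes f: "bij_betw f V {1..n}" and x: "x \<in> V"
  shows "f x = card {y \<in> V. f y \<le> f x}"
proof -
  have "f ` {y \<in> V. f y \<le> f x} = {1..f x}"
  proof
    show "f ` {y \<in> V. f y \<le> f x} \<subseteq> {1..f x}" using f by (auto simp: bij_betw_def)
    have "f x \<le> n" using f x by (auto simp: bij_betw_def)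
    then show "{1..f x} \<subseteq> f ` {y \<in> V. f y \<le> f x}"
      using f unfolding bij_betw_def by (auto simp: image_iff) (metis (mono_tags, lifting) atLeastAtMost_iff imageE order_trans)
  qed
  moreover have "inj_on f {y \<in> V. f y \<le> f x}" using f by (auto simp: bij_betw_def inj_on_def)
  ultimately show ?thesis by (metis card_atLeastAtMost card_image diff_Suc_1)
qed

section \<open>A permutree is determined by its in-order reading\<close>

text \<open>Otherwise the images are incomparable, and a wall at some \<open>t'\<close> comparable
  to \<open>f i\<close> separates them. Its preimage \<open>t\<close> lies below \<open>i\<close> or
  above \<open>j\<close> by \<open>between_arrow\<close>, and \<open>s\<close> decides which. Then
  \<open>i\<close> and \<open>j\<close> are on the same side of the wall at \<open>t\<close>,
  although its label is between theirs.\<close>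

lemma arrow_imp_path:
  assumes "permutree_poset A p up down V s" "permutree_poset A' p' up' down' V' s'"
    and f: "bij_betw f V V'"
    and fp: "\<And>v. v \<in> V \<Longrightarrow> p' (f v) = p v" and fs: "\<And>v. v \<in> V \<Longrightarrow> s' (f v) = s v"
    and fu: "\<And>v. v \<in> V \<Longrightarrow> up' (f v) = up v" and fd: "\<And>v. v \<in> V \<Longrightarrow> down' (f v) = down v"
    and ij: "(i, j) \<in> A"
  shows "(f i, f j) \<in> A'\<^sup>+"
proof (rule ccontr)
  interpret A: permutree_poset A p up down V s by fact
  interpret A': permutree_poset A' p' up' down' V' s' by fact
  assume no: "(f i, f j) \<notin> A'\<^sup>+"
  have V: "i \<in> V" "j \<in> V" using ij A.arrows_sub by auto
  have V': "f i \<in> V'" "f j \<in> V'" using V f by (auto simp: bij_betw_def)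
  have "s i < s j" using ij by (rule A.s_less)
  then have "s' (f i) < s' (f j)" using fs V by simp
  then have "(f j, f i) \<notin> A'\<^sup>+" "f i \<noteq> f j" using A'.trancl_s_less[of "f j" "f i"] by auto
  then have "(f i, f j) \<notin> A'\<^sup>*" "(f j, f i) \<notin> A'\<^sup>*" using no by (auto simp: rtrancl_eq_or_trancl)
  from A'.incomparable_separated[OF A'.connected[OF V'] this]
  obtain t' where t': "p' (f i) < p' t' \<and> p' t' < p' (f j) \<or> p' (f j) < p' t' \<and> p' t' < p' (f i)"
    "down' t' \<and> (f i, t') \<in> A'\<^sup>+ \<or> up' t' \<and> (t', f i) \<in> A'\<^sup>+" by blast
  have "t' \<in> V'" using t'(2) A'.trancl_in_V by blast
  then obtain t where t: "t \<in> V" "t' = f t" using f by (auto simp: bij_betw_def)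
  have btw: "p i < p t \<and> p t < p j \<or> p j < p t \<and> p t < p i" using t'(1) t V fp by simp
  have s: "(t, i) \<in> A\<^sup>+ \<or> (j, t) \<in> A\<^sup>+"
    using A.between_arrow[OF ij A.connected[OF V(1) t(1)] btw] .
  show False
    using t'(2)
  proof
    assume d: "down' t' \<and> (f i, t') \<in> A'\<^sup>+"
    then have "s i < s t" using A'.trancl_s_less[of "f i" "f t"] t fs V by auto
    then have "(j, t) \<in> A\<^sup>+" using s A.trancl_s_less by (meson order.asym)
    then obtain c where c: "(j, c) \<in> A\<^sup>*" "(c, t) \<in> A" by (meson tranclD2)
    have "(i, c) \<in> A\<^sup>*" using c ij by auto
    moreover have "down t" using d t fd by auto
    ultimately show False
      using A.descendants_side[OF _ c(2), of i] A.descendants_side[OF _ c(2) c(1)] btw by auto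
  next
    assume u: "up' t' \<and> (t', f i) \<in> A'\<^sup>+"
    then have "s t < s i" using A'.trancl_s_less[of "f t" "f i"] t fs V by auto
    then have "s t < s j" using \<open>s i < s j\<close> by simp
    then have "(t, i) \<in> A\<^sup>+" using s A.trancl_s_less by (meson order.asym)
    then obtain c where c: "(t, c) \<in> A" "(c, i) \<in> A\<^sup>*" by (meson tranclD)
    have "(c, j) \<in> A\<^sup>*" using c ij by auto
    moreover have "up t" using u t fu by auto
    ultimately show False
      using A.ancestors_side[OF _ c(1), of j] A.ancestors_side[OF _ c(1) c(2)] btw by auto
  qed
qed

text \<open>Paths transfer in both directions by \<open>arrow_imp_path\<close>. An image path with
  an intermediate vertex would pull back to one between \<open>i\<close> and \<open>j\<close>,
  against \<open>edge_covers\<close>.\<close>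

lemma arrow_imp_arrow:
  assumes "permutree_poset A p up down V s" "permutree_poset A' p' up' down' V' s'"
    and f: "bij_betw f V V'"
    and fp: "\<And>v. v \<in> V \<Longrightarrow> p' (f v) = p v" and fs: "\<And>v. v \<in> V \<Longrightarrow> s' (f v) = s v"
    and fu: "\<And>v. v \<in> V \<Longrightarrow> up' (f v) = up v" and fd: "\<And>v. v \<in> V \<Longrightarrow> down' (f v) = down v"
    and ij: "(i, j) \<in> A"
  shows "(f i, f j) \<in> A'"
proof (rule ccontr)
  interpret A: permutree_poset A p up down V s by fact
  interpret A': permutree_poset A' p' up' down' V' s' by fact
  assume no: "(f i, f j) \<notin> A'"
  define g where "g = inv_into V f"
  have gf: "g (f v) = v" if "v \<in> V" for v using that f by (simp add: g_def bij_betw_def)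
  have fg: "g v \<in> V" "f (g v) = v" if "v \<in> V'" for v
    using that f by (auto simp: g_def bij_betw_def f_inv_into_f inv_into_into)
  have g: "bij_betw g V' V" unfolding g_def by (rule bij_betw_inv_into[OF f])
  have arrow_back: "(g x, g y) \<in> A\<^sup>+" if "(x, y) \<in> A'" for x y
    by (rule arrow_imp_path[OF assms(2,1) g _ _ _ _ that]) (use fp fs fu fd fg in metis)+
  have path_back: "(g x, g y) \<in> A\<^sup>+" if "(x, y) \<in> A'\<^sup>+" for x y
    using that by (induction rule: trancl_induct) (use arrow_back in \<open>auto intro: trancl_trans\<close>)
  have V: "i \<in> V" "j \<in> V" using ij A.arrows_sub by auto
  have "(f i, f j) \<in> A'\<^sup>+" by (rule arrow_imp_path) fact+
  then obtain c where c: "(f i, c) \<in> A'" "(c, f j) \<in> A'\<^sup>*" by (meson tranclD)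
  then have "(c, f j) \<in> A'\<^sup>+" using no by (auto simp: rtrancl_eq_or_trancl)
  then have "(i, g c) \<in> A\<^sup>+" "(g c, j) \<in> A\<^sup>+" using path_back[of "f i" c] path_back[of c "f j"] c gf V by auto
  then show False using A.edge_covers[OF A.acyclic ij] by blast
qed

section \<open>The permutree of a permutation\<close>

text \<open>
  A vertex \<open>i\<close> is drawn at abscissa \<open>i\<close> and height \<open>w i\<close>. The walls met by a horizontal line just
  above height \<open>t\<close> cut it into regions. From each region that touches \<open>i\<close> just above height \<open>w i\<close>,
  an arrow goes to the first vertex above \<open>i\<close> that touches this region. Two distinct vertices touch
  a common region, which is then unique, if and only if no wall is strictly between them (\<open>sees\<close>);
  so \<open>k\<close> touches the region common to \<open>i\<close> and \<open>j\<close> if and only if it sees both.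
\<close>

definition walls ::
  "nat set \<Rightarrow> (nat \<Rightarrow> int) \<Rightarrow> (nat \<Rightarrow> bool) \<Rightarrow> (nat \<Rightarrow> bool) \<Rightarrow> int \<Rightarrow> nat set" where
  "walls I w up down t = {m \<in> I. up m \<and> w m \<le> t \<or> down m \<and> t < w m}"

definition sees :: "nat set \<Rightarrow> nat \<Rightarrow> nat \<Rightarrow> bool" where
  "sees W x y \<longleftrightarrow> (\<forall>m\<in>W. \<not> (x < m \<and> m < y) \<and> \<not> (y < m \<and> m < x))"

definition perm_arrows ::
  "nat set \<Rightarrow> (nat \<Rightarrow> int) \<Rightarrow> (nat \<Rightarrow> bool) \<Rightarrow> (nat \<Rightarrow> bool) \<Rightarrow> (nat \<times> nat) set" where
  "perm_arrows I w up down = {(i, j). i \<in> I \<and> j \<in> I \<and> w i < w j \<and>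
     sees (walls I w up down (w i)) i j \<and>
     (\<forall>k\<in>I. w i < w k \<and> w k < w j \<longrightarrow>
        \<not> (sees (walls I w up down (w i)) i k \<and> sees (walls I w up down (w i)) j k))}"

section \<open>Visibility between walls, and the conditions on arrows\<close>

lemma sees_sym: "sees W x y \<longleftrightarrow> sees W y x"
  unfolding sees_def by auto

lemma sees_refl: "sees W x x"
  unfolding sees_def by auto

text \<open>A vertex with no wall on the line touches only one region.\<close>

lemma sees_via_nonwall: "\<lbrakk>sees W i j; sees W i k; i \<notin> W\<rbrakk> \<Longrightarrow> sees W j k"
  unfolding sees_def by (metis linorder_neqE_nat)

lemma sees_same_side:
  assumes "sees W i j" "sees W i k" "j < i \<and> k < i \<or> i < j \<and> i < k"
  shows "sees W j k"
  using assms unfolding sees_def by (meson order.strict_trans)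

text \<open>If a wall \<open>m\<close> is strictly between \<open>x\<close> and \<open>y\<close>,
  then \<open>m\<close> is the only vertex that both can see.\<close>

lemma sees_two_common:
  assumes "sees W x j" "sees W x k" "sees W y j" "sees W y k" "j \<noteq> k"
  shows "sees W x y"
  using assms unfolding sees_def by (metis linorder_neqE_nat)

locale wall_diagram =
  fixes I :: "nat set" and w :: "nat \<Rightarrow> int" and up down :: "nat \<Rightarrow> bool"
  assumes finite_I: "finite I" and inj_w: "inj_on w I"
begin

text \<open>
  Turning the picture upside down replaces the line just above \<open>i\<close> by the line just below \<open>j\<close>. No
  vertex between these heights touches the region that carries the arrow, so the region is the same
  on both lines.
\<close>

lemma perm_arrows_dual:
  assumes "(i, j) \<in> perm_arrows I w up down"
  shows "(j, i) \<in> perm_arrows I (\<lambda>m. - w m) down up"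
proof -
  define W where "W = walls I w up down (w i)"
  define W' where "W' = walls I (\<lambda>m. - w m) down up (- w j)"
  have I: "i \<in> I" "j \<in> I" and wij: "w i < w j" and vis: "sees W i j"
    and noW: "\<And>k. \<lbrakk>k \<in> I; w i < w k; w k < w j; sees W i k; sees W j k\<rbrakk> \<Longrightarrow> False"
    using assms unfolding perm_arrows_def W_def by auto
  \<comment> \<open>A wall that blocks the line below \<open>j\<close> but not the one above
    \<open>i\<close> starts at a height strictly between; its vertex would touch the region and stop
    the arrow earlier.\<close>
  have vis': "sees W' i j"
  proof (rule ccontr)
    assume "\<not> sees W' i j"
    then obtain m where m: "m \<in> W'" "i < m \<and> m < j \<or> j < m \<and> m < i" unfolding sees_def by auto
    then have "m \<notin> W" using vis unfolding sees_def by auto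
    then have "w i < w m" "w m < w j" "m \<in> I" using m wij by (auto simp: W_def W'_def walls_def)
    moreover have "sees W i m" "sees W j m" using vis m(2) unfolding sees_def by auto
    ultimately show False using noW by blast
  qed
  \<comment> \<open>Such a \<open>k\<close> must be hidden on the line above \<open>i\<close> by a
    wall \<open>m\<close> of \<open>W\<close>. This \<open>m\<close> is again a counterexample,
    horizontally nearer to \<open>i\<close>.\<close>
  have noW': False if "k \<in> I" "w i < w k" "w k < w j" "sees W' i k" "sees W' j k" for k
    using that
  proof (induction "nat \<bar>int k - int i\<bar>" arbitrary: k rule: less_induct)
    case less
    from noW[of k] less.prems have "\<not> sees W i k \<or> \<not> sees W j k" by auto
    then obtain m where m: "m \<in> W" "i < m \<and> m < k \<or> k < m \<and> m < i \<or> j < m \<and> m < k \<or> k < m \<and> m < j"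
      unfolding sees_def by auto
    have out: "\<not> (i < m \<and> m < j \<or> j < m \<and> m < i)" using vis m(1) unfolding sees_def by auto
    have "m \<notin> W'" using m(2) less.prems(4,5) unfolding sees_def by auto
    then have mw: "w i < w m" "w m < w j" "m \<in> I"
      using m(1) wij by (auto simp: W_def W'_def walls_def)
    then have "m \<noteq> i" "m \<noteq> j" by auto
    then have "i < m \<and> j < m \<and> m < k \<or> m < i \<and> m < j \<and> k < m" using m(2) out by linarith
    then have "sees W' i m" "sees W' j m" "nat \<bar>int m - int i\<bar> < nat \<bar>int k - int i\<bar>"
      using less.prems(4,5) unfolding sees_def by auto
    then show False using less.hyps[of m] mw by auto
  qed
  show ?thesis
    using I wij vis' noW' sees_sym unfolding perm_arrows_def W'_def by fastforce
qed

lemma dual: "wall_diagram I (\<lambda>m. - w m)"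
  using finite_I inj_w by unfold_locales (auto simp: inj_on_def)

lemma perm_arrows_converse: "perm_arrows I (\<lambda>m. - w m) down up = (perm_arrows I w up down)\<inverse>"
  using perm_arrows_dual wall_diagram.perm_arrows_dual[OF dual, of _ _ down up] by auto

text \<open>If no wall above \<open>v\<close> separates them, both parents touch the same region;
  then the lower one, \<open>u\<close>, blocks the arrow to \<open>u'\<close>.\<close>

lemma perm_arrows_branch:
  assumes vu: "(v, u) \<in> perm_arrows I w up down" and vu': "(v, u') \<in> perm_arrows I w up down"
    and less: "w u < w u'"
  shows "up v \<and> (u < v \<and> v < u' \<or> u' < v \<and> v < u)"
proof (rule ccontr)
  assume not: "\<not> ?thesis"
  define W where "W = walls I w up down (w v)"
  have vis: "sees W v u" "sees W v u'" and I: "u \<in> I" and wv: "w v < w u" "w v < w u'"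
    using vu vu' unfolding perm_arrows_def W_def by auto
  have "v \<noteq> u" "v \<noteq> u'" using wv by auto
  then have "\<not> up v \<or> u < v \<and> u' < v \<or> v < u \<and> v < u'" using not by auto
  moreover have "v \<notin> W" if "\<not> up v" using that by (simp add: W_def walls_def)
  ultimately have "sees W u u'" using vis sees_via_nonwall sees_same_side by metis
  then show False
    using vu' I less wv vis sees_sym unfolding perm_arrows_def W_def by blast
qed

text \<open>The wall above \<open>v\<close> meets every line above height \<open>w v\<close>, so no
  later arrow of the path can cross it.\<close>

lemma perm_arrows_side:
  assumes "up v" "(v, u) \<in> perm_arrows I w up down" "(u, x) \<in> (perm_arrows I w up down)\<^sup>*"
  shows "w v < w x \<and> (u < v \<and> x < v \<or> v < u \<and> v < x)"
  using assms(3)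
proof (induction rule: rtrancl_induct)
  case base
  then have "w v < w u" using assms(2) by (auto simp: perm_arrows_def)
  then show ?case by (metis less_irrefl linorder_neqE_nat)
next
  case (step y z)
  have yz: "w y < w z" "sees (walls I w up down (w y)) y z"
    using step.hyps by (auto simp: perm_arrows_def)
  have "v \<in> walls I w up down (w y)"
    using assms(1,2) step.IH by (auto simp: walls_def perm_arrows_def)
  moreover have "z \<noteq> v" using step.IH yz by auto
  ultimately show ?case using step.IH yz unfolding sees_def by (metis linorder_neqE_nat order.strict_trans)
qed

lemma walled_digraph_perm_arrows: "walled_digraph (perm_arrows I w up down) int up down"
proof -
  \<comment> \<open>Stated for all heights and walls, so that the conditions on children are
    instances for the picture turned upside down.\<close>
  have branch: "up v \<and> (int u < int v \<and> int v < int u' \<or> int u' < int v \<and> int v < int u)"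
    if D: "wall_diagram I w" and "(v, u) \<in> perm_arrows I w up down"
      "(v, u') \<in> perm_arrows I w up down" "u \<noteq> u'"
    for v u u' w and up down :: "nat \<Rightarrow> bool"
  proof -
    have "w u \<noteq> w u'"
      using that wall_diagram.inj_w[OF D] by (auto simp: perm_arrows_def dest: inj_onD)
    then show ?thesis
      using wall_diagram.perm_arrows_branch[OF D] that(2,3) by (metis linorder_neqE of_nat_less_iff)
  qed
  have side: "int u < int v \<and> int x < int v \<or> int v < int u \<and> int v < int x"
    if "wall_diagram I w" "up v" "(v, u) \<in> perm_arrows I w up down"
      "(u, x) \<in> (perm_arrows I w up down)\<^sup>*"
    for v u x w and up down :: "nat \<Rightarrow> bool"
    using wall_diagram.perm_arrows_side[OF that] by auto
  show ?thesis
  proof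
    fix v u u' assume "(v, u) \<in> perm_arrows I w up down" "(v, u') \<in> perm_arrows I w up down" "u \<noteq> u'"
    then show "up v \<and> (int u < int v \<and> int v < int u' \<or> int u' < int v \<and> int v < int u)"
      by (rule branch[OF wall_diagram_axioms])
  next
    fix v u x
    assume "up v" "(v, u) \<in> perm_arrows I w up down" "(u, x) \<in> (perm_arrows I w up down)\<^sup>*"
    then show "int u < int v \<and> int x < int v \<or> int v < int u \<and> int v < int x"
      by (rule side[OF wall_diagram_axioms])
  next
    fix v u u' assume "(u, v) \<in> perm_arrows I w up down" "(u', v) \<in> perm_arrows I w up down" "u \<noteq> u'"
    then show "down v \<and> (int u < int v \<and> int v < int u' \<or> int u' < int v \<and> int v < int u)"
      by (intro branch[OF dual, of _ _ down up]) (auto simp: perm_arrows_converse)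
  next
    fix v u x
    assume "down v" "(u, v) \<in> perm_arrows I w up down" "(x, u) \<in> (perm_arrows I w up down)\<^sup>*"
    then show "int u < int v \<and> int x < int v \<or> int v < int u \<and> int v < int x"
      by (intro side[OF dual, of down _ _ up]) (auto simp: perm_arrows_converse rtrancl_converse)
  qed
qed

text \<open>
  The first vertex above \<open>j\<close> in the region between walls shared by \<open>j\<close> and \<open>x\<close> is the parent of \<open>j\<close>
  there, and it still shares a region with \<open>x\<close>.
\<close>

lemma sees_imp_path:
  assumes "j \<in> I" "x \<in> I" "w j < w x" "sees (walls I w up down (w j)) j x"
  shows "(j, x) \<in> (perm_arrows I w up down)\<^sup>+"
  using assms
proof (induction "nat (w x - w j)" arbitrary: j rule: less_induct)
  case less
  define W where "W = walls I w up down (w j)"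
  \<comment> \<open>The vertices above \<open>j\<close>, up to the height of \<open>x\<close>, in
    the region that \<open>j\<close> and \<open>x\<close> share. It contains \<open>x\<close>, and
    its lowest element is the parent \<open>k\<close> of \<open>j\<close> there.\<close>
  define K where "K = {k \<in> I. w j < w k \<and> w k \<le> w x \<and> sees W j k \<and> sees W x k}"
  have jx: "sees W j x" using less.prems by (simp add: W_def)
  have xK: "x \<in> K" using less.prems jx by (simp add: K_def sees_refl)
  have "finite K" "K \<noteq> {}" using finite_I xK by (auto simp: K_def)
  then obtain k where "is_arg_min w (\<lambda>k. k \<in> K) k" using ex_is_arg_min_if_finite by blast
  then have k: "k \<in> K" and min: "\<And>k'. k' \<in> K \<Longrightarrow> w k \<le> w k'" by (auto simp: is_arg_min_linorder)
  have kI: "k \<in> I" "w j < w k" "w k \<le> w x" "sees W j k" "sees W x k" using k by (auto simp: K_def)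
  have jk: "(j, k) \<in> perm_arrows I w up down"
  proof -
    have False if h: "h \<in> I" "w j < w h" "w h < w k" "sees W j h" "sees W k h" for h
    proof -
      have "j \<noteq> k" using kI by auto
      then have "sees W x h" using sees_two_common[of W x j k h] jx kI h by (simp add: sees_sym)
      then have "h \<in> K" using h kI by (simp add: K_def)
      then show False using min h by force
    qed
    then have "\<forall>h\<in>I. w j < w h \<and> w h < w k \<longrightarrow> \<not> (sees W j h \<and> sees W k h)" by blast
    then show ?thesis using less.prems(1) kI(1,2,4) unfolding perm_arrows_def W_def by simp
  qed
  show ?case
  proof (cases "k = x")
    case True
    then show ?thesis using jk by blast
  next
    case False
    then have "w k \<noteq> w x" using inj_onD[OF inj_w _ kI(1) less.prems(2)] by blast
    then have kx: "w k < w x" using kI by simp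
    \<comment> \<open>A new wall between \<open>k\<close> and \<open>x\<close> would belong to a
      vertex of \<open>K\<close> no higher than \<open>k\<close>, hence to \<open>k\<close> itself,
      which is not strictly between.\<close>
    have "sees (walls I w up down (w k)) k x"
    proof (rule ccontr)
      assume "\<not> ?thesis"
      then obtain m where m: "m \<in> walls I w up down (w k)" "k < m \<and> m < x \<or> x < m \<and> m < k"
        unfolding sees_def by auto
      have "m \<notin> W" using m(2) kI(5) unfolding sees_def by auto
      then have mI: "m \<in> I" "w j < w m" "w m \<le> w k" using m(1) kI by (auto simp: walls_def W_def)
      have "sees W x m" using m(2) kI(5) unfolding sees_def by auto
      moreover have "sees W j m" unfolding sees_def
      proof (intro ballI conjI notI)
        fix h assume h: "h \<in> W"
        have "h \<noteq> m" using h \<open>m \<notin> W\<close> by auto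
        have "\<not> (j < h \<and> h < k)" "\<not> (k < h \<and> h < j)" "\<not> (j < h \<and> h < x)" "\<not> (x < h \<and> h < j)"
          using h kI(4) jx unfolding sees_def by auto
        then show "j < h \<and> h < m \<Longrightarrow> False" "m < h \<and> h < j \<Longrightarrow> False" using m(2) by auto
      qed
      ultimately have "w k \<le> w m" using min mI kx by (auto simp: K_def)
      then have "m = k" using mI kI inj_w by (auto dest: inj_onD)
      then show False using m by auto
    qed
    then have "(k, x) \<in> (perm_arrows I w up down)\<^sup>+"
      using less.hyps[of k] kI kx less.prems by auto
    then show ?thesis using jk by simp
  qed
qed

end

text \<open>Consecutive labels have no integer between them, so no wall can hide one from the other,
  and \<open>sees_imp_path\<close> joins them.\<close>

lemma perm_arrows_connected:
  fixes up down :: "nat \<Rightarrow> bool"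
  assumes "inj_on w {1..n}" "x \<in> {1..n}" "y \<in> {1..n}"
  defines "A \<equiv> perm_arrows {1..n} w up down"
  shows "(x, y) \<in> (A \<union> A\<inverse>)\<^sup>*"
proof -
  interpret wall_diagram "{1..n}" w using assms(1) by unfold_locales auto
  have path: "(i, j) \<in> (A \<union> A\<inverse>)\<^sup>*" if "(i, j) \<in> A\<^sup>+ \<or> (j, i) \<in> A\<^sup>+" for i j
  proof -
    have "(i, j) \<in> A\<^sup>* \<or> (i, j) \<in> (A\<inverse>)\<^sup>*"
      using that by (auto simp: rtrancl_converse trancl_into_rtrancl)
    then show ?thesis using rtrancl_mono[of A "A \<union> A\<inverse>"] rtrancl_mono[of "A\<inverse>" "A \<union> A\<inverse>"] by blast
  qed
  have next_label: "(i, Suc i) \<in> (A \<union> A\<inverse>)\<^sup>*" if i: "1 \<le> i" "Suc i \<le> n" for i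
  proof -
    have "sees W i (Suc i)" "sees W (Suc i) i" for W by (auto simp: sees_def)
    moreover have "w i \<noteq> w (Suc i)" using i inj_w by (auto dest: inj_onD)
    ultimately show ?thesis
      using sees_imp_path[of i "Suc i"] sees_imp_path[of "Suc i" i] i path
      unfolding A_def by (metis atLeastAtMost_iff le_SucI linorder_neqE Suc_leD)
  qed
  have up: "(a, b) \<in> (A \<union> A\<inverse>)\<^sup>*" if "a \<le> b" "1 \<le> a" "b \<le> n" for a b
    using that
  proof (induction rule: dec_induct)
    case (step k)
    then show ?case using next_label[of k] by (meson Suc_leD order_trans rtrancl_trans)
  qed simp
  have "sym ((A \<union> A\<inverse>)\<^sup>*)" by (intro sym_rtrancl) (auto simp: sym_def)
  then show ?thesis using up[of x y] up[of y x] assms(2,3) by (cases x y rule: le_cases) (auto dest: symD)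
qed

section \<open>Permutrees as walled digraphs\<close>

abbreviation up_wall :: "decoration list \<Rightarrow> nat \<Rightarrow> bool" where
  "up_wall \<delta> k \<equiv> decoration_at \<delta> k \<in> {UpWall, BothWalls}"

abbreviation down_wall :: "decoration list \<Rightarrow> nat \<Rightarrow> bool" where
  "down_wall \<delta> k \<equiv> decoration_at \<delta> k \<in> {DownWall, BothWalls}"

lemma not_up_wall: "decoration_at \<delta> k \<in> {NoWall, DownWall} \<longleftrightarrow> \<not> up_wall \<delta> k"
  by (cases "decoration_at \<delta> k") auto

lemma not_down_wall: "decoration_at \<delta> k \<in> {NoWall, UpWall} \<longleftrightarrow> \<not> down_wall \<delta> k"
  by (cases "decoration_at \<delta> k") auto

text \<open>A cycle, followed from its first vertex back to it, is a closed walk without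
  backtracking; length at least 3 ensures this also for the closing step.\<close>

lemma (in walled_digraph) no_undirected_cycle:
  assumes "acyclic A" "arrows T = A"
  shows "\<not> undirected_cycle T c"
proof
  assume "undirected_cycle T c"
  then have len: "3 \<le> length c" and dist: "distinct c"
    and edge: "\<And>i. Suc i < length c \<Longrightarrow> (c ! i, c ! Suc i) \<in> A \<union> A\<inverse>"
    and closing: "(last c, hd c) \<in> A \<union> A\<inverse>"
    unfolding undirected_cycle_def edges_def assms(2) by auto
  have walk: "nb_walk (A \<union> A\<inverse>) (c ! 0) (c ! 1) (c ! k) (c ! Suc k)" if "Suc k < length c" for k
    using that
  proof (induction k)
    case 0
    then show ?case using edge[of 0] by (auto intro: nb_walk.first)
  next
    case (Suc k)
    have "c ! Suc (Suc k) \<noteq> c ! k" using dist Suc.prems by (simp add: nth_eq_iff_index_eq)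
    then show ?case using Suc edge[of "Suc k"] by (metis Suc_lessD nb_walk.step)
  qed
  obtain k where k: "length c = Suc (Suc k)" "k \<noteq> 0"
    using len by (cases "length c"; cases "length c - 1") auto
  have "c \<noteq> []" using len by auto
  then have ends: "last c = c ! Suc k" "hd c = c ! 0" using k by (auto simp: last_conv_nth hd_conv_nth)
  have "c ! 0 \<noteq> c ! k" using dist k by (simp add: nth_eq_iff_index_eq)
  then have "nb_walk (A \<union> A\<inverse>) (c ! 0) (c ! 1) (c ! Suc k) (c ! 0)"
    using walk[of k] k closing nb_walk.step unfolding ends by fastforce
  then show False using no_closed_walk[OF assms(1)] by blast
qed

lemma permutreeI:
  assumes fin: "finite (verts T)" and sub: "arrows T \<subseteq> verts T \<times> verts T"
    and bij: "bij_betw (label T) (verts T) {1..length \<delta>}"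
    and walled: "walled_digraph (arrows T) (\<lambda>v. int (label T v))
      (\<lambda>v. up_wall \<delta> (label T v)) (\<lambda>v. down_wall \<delta> (label T v))"
    and acyc: "acyclic (arrows T)"
    and conn: "\<And>x y. \<lbrakk>x \<in> verts T; y \<in> verts T\<rbrakk> \<Longrightarrow> (x, y) \<in> (arrows T \<union> (arrows T)\<inverse>)\<^sup>*"
  shows "permutree \<delta> T"
proof -
  interpret walled_digraph "arrows T" "\<lambda>v. int (label T v)"
    "\<lambda>v. up_wall \<delta> (label T v)" "\<lambda>v. down_wall \<delta> (label T v)" by fact
  have "irrefl (arrows T)" using acyc by (auto simp: acyclic_def irrefl_def)
  moreover have "antisym (arrows T)"
    using acyc by (auto simp: acyclic_def antisym_def) (meson r_into_trancl' trancl_into_trancl)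
  ultimately have tree: "directed_tree T"
    unfolding directed_tree_def edges_def using fin sub conn no_undirected_cycle[OF acyc refl] by auto
  show ?thesis
    unfolding permutree_def not_up_wall not_down_wall parents_def children_def ancestors_def
      descendants_def Uniq_def Ball_def mem_Collect_eq
  proof (intro conjI impI allI)
    fix v u x assume "up_wall \<delta> (label T v)" "(v, u) \<in> arrows T" "(u, x) \<in> (arrows T)\<^sup>+"
    note side = ancestors_side[OF this(1,2) trancl_into_rtrancl[OF this(3)]]
    show "label T x < label T v" if "label T u < label T v" using that side by auto
    show "label T v < label T x" if "label T v < label T u" using that side by auto
  next
    fix v u x assume "down_wall \<delta> (label T v)" "(u, v) \<in> arrows T" "(x, u) \<in> (arrows T)\<^sup>+"
    note side = descendants_side[OF this(1,2) trancl_into_rtrancl[OF this(3)]]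
    show "label T x < label T v" if "label T u < label T v" using that side by auto
    show "label T v < label T x" if "label T v < label T u" using that side by auto
  next
    fix v u u' assume "(v, u) \<in> arrows T \<and> label T u < label T v" "(v, u') \<in> arrows T \<and> label T u' < label T v"
    then show "u = u'" using parents_branch[of v u u'] by auto
  next
    fix v u u' assume "(v, u) \<in> arrows T \<and> label T v < label T u" "(v, u') \<in> arrows T \<and> label T v < label T u'"
    then show "u = u'" using parents_branch[of v u u'] by auto
  next
    fix v u u' assume "(u, v) \<in> arrows T \<and> label T u < label T v" "(u', v) \<in> arrows T \<and> label T u' < label T v"
    then show "u = u'" using children_branch[of u v u'] by auto
  next
    fix v u u' assume "(u, v) \<in> arrows T \<and> label T v < label T u" "(u', v) \<in> arrows T \<and> label T v < label T u'"
    then show "u = u'" using children_branch[of u v u'] by auto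
  next
    fix v u u' assume "\<not> up_wall \<delta> (label T v)" "(v, u) \<in> arrows T" "(v, u') \<in> arrows T"
    then show "u = u'" using parents_branch[of v u u'] by blast
  next
    fix v u u' assume "\<not> down_wall \<delta> (label T v)" "(u, v) \<in> arrows T" "(u', v) \<in> arrows T"
    then show "u = u'" using children_branch[of u v u'] by blast
  qed (fact tree bij)+
qed

text \<open>Two parents or two children force the corresponding wall, and uniqueness on each side
  then puts them on opposite sides; labels of adjacent vertices differ by injectivity.\<close>

lemma permutree_walled_digraph:
  assumes "permutree \<delta> T"
  shows "walled_digraph (arrows T) (\<lambda>v. int (label T v))
    (\<lambda>v. up_wall \<delta> (label T v)) (\<lambda>v. down_wall \<delta> (label T v))"
proof -
  have sub: "arrows T \<subseteq> verts T \<times> verts T" and irr: "irrefl (arrows T)"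
    and inj: "inj_on (label T) (verts T)"
    using assms by (auto simp: permutree_def directed_tree_def bij_betw_def)
  have ne: "label T u \<noteq> label T v" if "(u, v) \<in> arrows T" for u v
    using that sub irr inj by (auto simp: irrefl_def dest: inj_onD)
  have V: "u \<in> verts T" "v \<in> verts T" if "(u, v) \<in> arrows T" for u v using that sub by auto
  note D = assms[unfolded permutree_def not_up_wall not_down_wall, THEN conjunct2, THEN conjunct2,
    THEN bspec, unfolded parents_def children_def ancestors_def descendants_def Uniq_def
    Ball_def mem_Collect_eq]
  note one_parent = D[THEN conjunct1, THEN mp]
  note one_child = D[THEN conjunct2, THEN conjunct1, THEN mp]
  note up = D[THEN conjunct2, THEN conjunct2, THEN conjunct1, THEN mp]
  note down = D[THEN conjunct2, THEN conjunct2, THEN conjunct2, THEN mp]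
  have less: "label T u < label T v \<or> label T v < label T u"
    if "(v, u) \<in> arrows T \<or> (u, v) \<in> arrows T" for u v
    using that ne by (metis linorder_neqE_nat)
  show ?thesis
    unfolding walled_digraph_def of_nat_less_iff
  proof (intro conjI allI impI)
    fix v u u' assume A: "(v, u) \<in> arrows T" "(v, u') \<in> arrows T" "u \<noteq> u'"
    note v = V(1)[OF A(1)]
    show w: "up_wall \<delta> (label T v)" using one_parent[OF v] A by blast
    show "label T u < label T v \<and> label T v < label T u' \<or> label T u' < label T v \<and> label T v < label T u"
      using up[OF v w] less[of v u] less[of v u'] A by metis
  next
    fix v u u' assume A: "(u, v) \<in> arrows T" "(u', v) \<in> arrows T" "u \<noteq> u'"
    note v = V(2)[OF A(1)]
    show w: "down_wall \<delta> (label T v)" using one_child[OF v] A by blast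
    show "label T u < label T v \<and> label T v < label T u' \<or> label T u' < label T v \<and> label T v < label T u"
      using down[OF v w] less[of v u] less[of v u'] A by metis
  next
    fix v u x assume A: "up_wall \<delta> (label T v)" "(v, u) \<in> arrows T" "(u, x) \<in> (arrows T)\<^sup>*"
    show "label T u < label T v \<and> label T x < label T v \<or> label T v < label T u \<and> label T v < label T x"
      using up[OF V(1)[OF A(2)] A(1)] less[of v u] A(2) A(3)[unfolded rtrancl_eq_or_trancl] by metis
  next
    fix v u x assume A: "down_wall \<delta> (label T v)" "(u, v) \<in> arrows T" "(x, u) \<in> (arrows T)\<^sup>*"
    show "label T u < label T v \<and> label T x < label T v \<or> label T v < label T u \<and> label T v < label T x"
      using down[OF V(2)[OF A(2)] A(1)] less[of v u] A(2) A(3)[unfolded rtrancl_eq_or_trancl] by metis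
  qed
qed

lemma decreasing_permutree_poset:
  assumes "(T, \<sigma>) \<in> decreasing_permutrees \<delta>"
  shows "permutree_poset (arrows T) (\<lambda>v. int (label T v))
    (\<lambda>v. up_wall \<delta> (label T v)) (\<lambda>v. down_wall \<delta> (label T v)) (verts T) \<sigma>"
proof -
  have T: "permutree \<delta> T" and \<sigma>: "linear_extension T \<sigma>"
    using assms by (auto simp: decreasing_permutrees_def)
  have tree: "directed_tree T" and bij: "bij_betw (label T) (verts T) {1..length \<delta>}"
    using T by (auto simp: permutree_def)
  interpret walled_digraph "arrows T" "\<lambda>v. int (label T v)"
    "\<lambda>v. up_wall \<delta> (label T v)" "\<lambda>v. down_wall \<delta> (label T v)"
    using T by (rule permutree_walled_digraph)
  show ?thesis
  proof
    fix x y assume xy: "(x, y) \<in> arrows T"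
    then have V: "x \<in> verts T" "y \<in> verts T" and ne: "x \<noteq> y"
      using tree by (auto simp: directed_tree_def irrefl_def)
    then have "\<sigma> x \<noteq> \<sigma> y" using \<sigma> by (auto simp: linear_extension_def bij_betw_def dest: inj_onD)
    moreover have "\<sigma> x \<le> \<sigma> y" using \<sigma> V xy by (auto simp: linear_extension_def tree_le_def)
    ultimately show "\<sigma> x < \<sigma> y" by simp
  qed (use tree bij in \<open>auto simp: directed_tree_def edges_def bij_betw_def inj_on_def\<close>)
qed

section \<open>In-order readings: existence, and uniqueness up to renaming\<close>

lemma card_verts_permutree: "permutree \<delta> T \<Longrightarrow> card (verts T) = length \<delta>"
  unfolding permutree_def by (metis bij_betw_same_card card_atLeastAtMost diff_Suc_1)

lemma in_order_reading_label:
  assumes "permutree \<delta> T" "x \<in> verts T"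
  shows "in_order_reading (T, \<sigma>) (label T x) = \<sigma> x"
proof -
  have "label T x \<in> {1..card (verts T)}" "inj_on (label T) (verts T)"
    using assms card_verts_permutree[OF assms(1)] by (auto simp: permutree_def bij_betw_def)
  then show ?thesis using assms(2) by simp
qed

lemma in_order_reading_eqI:
  assumes "permutree \<delta> T" "w permutes {1..length \<delta>}" "\<And>x. x \<in> verts T \<Longrightarrow> w (label T x) = \<sigma> x"
  shows "in_order_reading (T, \<sigma>) = w"
proof
  fix i
  have bij: "bij_betw (label T) (verts T) {1..length \<delta>}" using assms(1) by (simp add: permutree_def)
  show "in_order_reading (T, \<sigma>) i = w i"
  proof (cases "i \<in> {1..length \<delta>}")
    case True
    then obtain x where "x \<in> verts T" "i = label T x"
      using bij unfolding bij_betw_def by (metis imageE)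
    then show ?thesis using in_order_reading_label[OF assms(1)] assms(3) by metis
  next
    case False
    then show ?thesis
      using permutes_not_in[OF assms(2) False] card_verts_permutree[OF assms(1)] by auto
  qed
qed

lemma decreasing_permutree_exists:
  assumes "w permutes {1..length \<delta>}"
  shows "\<exists>T \<sigma>. (T, \<sigma>) \<in> (decreasing_permutrees \<delta> :: (nat labelled_digraph \<times> (nat \<Rightarrow> nat)) set) \<and>
    in_order_reading (T, \<sigma>) = w"
proof -
  let ?I = "{1..length \<delta>}"
  let ?A = "perm_arrows ?I (\<lambda>k. int (w k)) (up_wall \<delta>) (down_wall \<delta>)"
  \<comment> \<open>Each vertex is its own label, so \<open>w\<close> itself, restricted to the
    vertices, is the linear extension.\<close>
  let ?T = "\<lparr>verts = ?I, arrows = ?A, label = id\<rparr>" and ?\<sigma> = "restrict w ?I"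
  have bij: "bij_betw w ?I ?I" using assms by (rule permutes_imp_bij)
  then have inj: "inj_on (\<lambda>k. int (w k)) ?I" by (auto simp: bij_betw_def inj_on_def)
  interpret wall_diagram ?I "\<lambda>k. int (w k)" "up_wall \<delta>" "down_wall \<delta>"
    using inj by unfold_locales auto
  have sub: "?A \<subseteq> ?I \<times> ?I" and mono: "\<And>x y. (x, y) \<in> ?A \<Longrightarrow> w x < w y"
    by (auto simp: perm_arrows_def)
  have mono_path: "w x < w y" if "(x, y) \<in> ?A\<^sup>+" for x y
    using that by (induction rule: trancl_induct) (blast intro: mono less_trans)+
  have T: "permutree \<delta> ?T"
  proof (rule permutreeI)
    show "acyclic (arrows ?T)" using mono_path by (fastforce simp: acyclic_def)
    show "walled_digraph (arrows ?T) (\<lambda>v. int (label ?T v))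
      (\<lambda>v. up_wall \<delta> (label ?T v)) (\<lambda>v. down_wall \<delta> (label ?T v))"
      using walled_digraph_perm_arrows by simp
  qed (use sub perm_arrows_connected[OF inj] in auto)
  moreover have "linear_extension ?T ?\<sigma>"
    using bij mono_path unfolding linear_extension_def tree_le_def
    by (auto simp: rtrancl_eq_or_trancl bij_betw_restrict_eq dest: less_imp_le)
  ultimately show ?thesis
    using in_order_reading_eqI[OF T assms, of ?\<sigma>] unfolding decreasing_permutrees_def
    by (intro exI[of _ ?T] exI[of _ ?\<sigma>]) auto
qed

lemma in_order_inv:
  assumes "w permutes {1..length \<delta>}"
  shows "in_order_inv \<delta> w \<in> decreasing_permutrees \<delta>" "in_order_reading (in_order_inv \<delta> w) = w"
proof -
  have "w \<in> in_order_reading ` (decreasing_permutrees \<delta> :: (nat labelled_digraph \<times> (nat \<Rightarrow> nat)) set)"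
    using decreasing_permutree_exists[OF assms] by (force simp: image_iff)
  then show "in_order_inv \<delta> w \<in> decreasing_permutrees \<delta>" "in_order_reading (in_order_inv \<delta> w) = w"
    unfolding in_order_inv_def by (auto intro: inv_into_into f_inv_into_f)
qed

text \<open>The only candidate for an isomorphism matches equal labels. Equal readings make it
  preserve the linear extensions, so \<open>arrow_imp_arrow\<close> applies to it and to its
  inverse.\<close>

lemma same_labelled_tree_if_same_reading:
  assumes T: "(T, \<sigma>) \<in> decreasing_permutrees \<delta>" and T': "(T', \<sigma>') \<in> decreasing_permutrees \<delta>"
    and eq: "in_order_reading (T, \<sigma>) = in_order_reading (T', \<sigma>')"
  shows "same_labelled_tree T T'"
proof -
  have P: "permutree \<delta> T" "permutree \<delta> T'" using T T' by (auto simp: decreasing_permutrees_def)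
  then have bij: "bij_betw (label T) (verts T) {1..length \<delta>}" "bij_betw (label T') (verts T') {1..length \<delta>}"
    by (auto simp: permutree_def)
  define g where "g = inv_into (verts T') (label T') \<circ> label T"
  define h where "h = inv_into (verts T) (label T) \<circ> label T'"
  have g: "bij_betw g (verts T) (verts T')" and h: "bij_betw h (verts T') (verts T)"
    unfolding g_def h_def using bij bij_betw_inv_into bij_betw_trans by blast+
  have gV: "g v \<in> verts T'" if "v \<in> verts T" for v using g that by (auto simp: bij_betw_def)
  have hV: "h v \<in> verts T" if "v \<in> verts T'" for v using h that by (auto simp: bij_betw_def)
  have gl: "label T' (g v) = label T v" if "v \<in> verts T" for v
    using that bij bij_betwE unfolding g_def comp_def by (metis bij_betw_inv_into_right)
  have hl: "label T (h v) = label T' v" if "v \<in> verts T'" for v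
    using that bij bij_betwE unfolding h_def comp_def by (metis bij_betw_inv_into_right)
  have gs: "\<sigma>' (g v) = \<sigma> v" if "v \<in> verts T" for v
    using in_order_reading_label[OF P(1) that, of \<sigma>] in_order_reading_label[OF P(2) gV[OF that], of \<sigma>']
      eq gl[OF that] by metis
  have hs: "\<sigma> (h v) = \<sigma>' v" if "v \<in> verts T'" for v
    using in_order_reading_label[OF P(2) that, of \<sigma>'] in_order_reading_label[OF P(1) hV[OF that], of \<sigma>]
      eq hl[OF that] by metis
  have hg: "h (g v) = v" if "v \<in> verts T" for v
    using that gl gV bij by (simp add: h_def bij_betw_def)
  have fwd: "(g x, g y) \<in> arrows T'" if "(x, y) \<in> arrows T" for x y
    by (rule arrow_imp_arrow[OF decreasing_permutree_poset[OF T] decreasing_permutree_poset[OF T'] g _ _ _ _ that])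
      (simp_all add: gl gs)
  have bwd: "(h x, h y) \<in> arrows T" if "(x, y) \<in> arrows T'" for x y
    by (rule arrow_imp_arrow[OF decreasing_permutree_poset[OF T'] decreasing_permutree_poset[OF T] h _ _ _ _ that])
      (simp_all add: hl hs)
  show ?thesis
    unfolding same_labelled_tree_def using g fwd bwd hg gl by (intro exI[of _ g]) metis
qed

section \<open>The left weak order\<close>

definition inversions :: "nat \<Rightarrow> (nat \<Rightarrow> nat) \<Rightarrow> (nat \<times> nat) set" where
  "inversions n w = {(i, j). i \<in> {1..n} \<and> j \<in> {1..n} \<and> i < j \<and> w i > w j}"

lemma finite_inversions: "finite (inversions n w)"
  by (rule finite_subset[of _ "{1..n} \<times> {1..n}"]) (auto simp: inversions_def)

text \<open>Two values of \<open>x\<close> are inverted by \<open>y \<circ> inv x\<close> exactly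
  when \<open>x\<close> and \<open>y\<close> order their positions differently; \<open>g\<close>
  maps a pair of positions to the sorted pair of its \<open>x\<close>-values.\<close>

lemma perm_length_comp_inv:
  assumes x: "x permutes {1..n}" and y: "y permutes {1..n}"
  shows "perm_length n (y \<circ> inv x) =
    card ((inversions n x - inversions n y) \<union> (inversions n y - inversions n x))"
proof -
  let ?D = "(inversions n x - inversions n y) \<union> (inversions n y - inversions n x)"
  define g where "g = (\<lambda>(i, j). (min (x i) (x j), max (x i) (x j)))"
  have injx: "x i = x j \<longleftrightarrow> i = j" for i j using permutes_inj[OF x] by (auto dest: injD)
  have injy: "y i = y j \<longleftrightarrow> i = j" for i j using permutes_inj[OF y] by (auto dest: injD)
  have inv: "inv x (x i) = i" "x (inv x i) = i" for i using permutes_inverses[OF x] by auto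
  have mem: "x i \<in> {1..n} \<longleftrightarrow> i \<in> {1..n}" "inv x i \<in> {1..n} \<longleftrightarrow> i \<in> {1..n}" for i
    using permutes_in_image[OF x] permutes_in_image[OF permutes_inv[OF x]] by auto
  have D: "(i, j) \<in> ?D \<longleftrightarrow> i \<in> {1..n} \<and> j \<in> {1..n} \<and> i < j \<and> (x j < x i \<longleftrightarrow> y i < y j)" for i j
    using injx[of i j] injy[of i j] unfolding inversions_def by auto
  have "inj_on g ?D"
  proof (rule inj_onI)
    fix a b assume ab: "a \<in> ?D" "b \<in> ?D" "g a = g b"
    obtain i j k l where eq: "a = (i, j)" "b = (k, l)" by (cases a, cases b)
    have "i < j" "k < l" using ab(1,2) unfolding eq D by auto
    moreover have "i = k \<and> j = l \<or> i = l \<and> j = k"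
      using ab(3) injx unfolding eq g_def by (auto simp: min_def max_def split: if_splits)
    ultimately show "a = b" unfolding eq by auto
  qed
  moreover have "g ` ?D = inversions n (y \<circ> inv x)"
  proof
    show "g ` ?D \<subseteq> inversions n (y \<circ> inv x)"
    proof (rule image_subsetI)
      fix a assume a: "a \<in> ?D"
      obtain i j where eq: "a = (i, j)" by (cases a)
      have "i \<in> {1..n}" "j \<in> {1..n}" "i < j" "x j < x i \<longleftrightarrow> y i < y j" using a unfolding eq D by auto
      then show "g a \<in> inversions n (y \<circ> inv x)"
        using mem(1)[of i] mem(1)[of j] injx[of i j] injy[of i j]
        unfolding eq g_def inversions_def by (auto simp: inv min_def max_def)
    qed
    show "inversions n (y \<circ> inv x) \<subseteq> g ` ?D"
    proof
      fix a assume a: "a \<in> inversions n (y \<circ> inv x)"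
      obtain b c where eq: "a = (b, c)" by (cases a)
      have bc: "b \<in> {1..n}" "c \<in> {1..n}" "b < c" "y (inv x c) < y (inv x b)"
        using a unfolding eq inversions_def by auto
      define i j where "i = inv x b" and "j = inv x c"
      have ij: "x i = b" "x j = c" "i \<in> {1..n}" "j \<in> {1..n}" "y j < y i"
        using bc mem by (auto simp: i_def j_def inv)
      have "i \<noteq> j" using ij bc by auto
      then consider "i < j" | "j < i" by linarith
      then show "a \<in> g ` ?D"
      proof cases
        case 1
        then have "(i, j) \<in> ?D" "g (i, j) = a" unfolding D using ij bc by (auto simp: g_def eq)
        then show ?thesis by (metis imageI)
      next
        case 2
        then have "(j, i) \<in> ?D" "g (j, i) = a" unfolding D using ij bc by (auto simp: g_def eq)
        then show ?thesis by (metis imageI)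
      qed
    qed
  qed
  ultimately have "card ?D = card (inversions n (y \<circ> inv x))" using card_image by metis
  then show ?thesis unfolding perm_length_def inversions_def by simp
qed

text \<open>The size of the symmetric difference equals the difference of the two sizes exactly when
  nothing is lost from the first set.\<close>

lemma left_weak_le_iff:
  assumes "x permutes {1..n}" "y permutes {1..n}"
  shows "left_weak_le n x y \<longleftrightarrow> inversions n x \<subseteq> inversions n y"
proof -
  let ?X = "inversions n x" and ?Y = "inversions n y"
  note fin = finite_inversions[of n x] finite_inversions[of n y]
  have "perm_length n (y \<circ> inv x) = card (?X - ?Y) + card (?Y - ?X)"
    unfolding perm_length_comp_inv[OF assms] using fin by (intro card_Un_disjoint) auto
  moreover have "card ?X = card (?X - ?Y) + card (?X \<inter> ?Y)"
    using card_Int_Diff[OF fin(1), of ?Y] by simp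
  moreover have "card ?Y = card (?Y - ?X) + card (?X \<inter> ?Y)"
    using card_Int_Diff[OF fin(2), of ?X] by (simp add: Int_commute)
  ultimately have "left_weak_le n x y \<longleftrightarrow> card (?X - ?Y) = 0"
    unfolding left_weak_le_def perm_length_def inversions_def[symmetric] by linarith
  then show ?thesis using fin by auto
qed

lemma inversions_inject:
  assumes x: "x permutes {1..n}" and y: "y permutes {1..n}" and eq: "inversions n x = inversions n y"
  shows "x = y"
proof
  fix i
  have le: "x j \<le> x i \<longleftrightarrow> y j \<le> y i" if "i \<in> {1..n}" "j \<in> {1..n}" for j
  proof -
    have "i \<noteq> j \<Longrightarrow> x i \<noteq> x j \<and> y i \<noteq> y j"
      using permutes_inj[OF x] permutes_inj[OF y] by (auto dest: injD)
    moreover have "(i, j) \<in> inversions n x \<longleftrightarrow> (i, j) \<in> inversions n y"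
      "(j, i) \<in> inversions n x \<longleftrightarrow> (j, i) \<in> inversions n y" using eq by auto
    ultimately show ?thesis using that unfolding inversions_def by (cases i j rule: linorder_cases) auto
  qed
  show "x i = y i"
  proof (cases "i \<in> {1..n}")
    case True
    then have "{j \<in> {1..n}. x j \<le> x i} = {j \<in> {1..n}. y j \<le> y i}" using le by auto
    then show ?thesis
      using rank_eq[OF permutes_imp_bij[OF x] True] rank_eq[OF permutes_imp_bij[OF y] True] by simp
  next
    case False
    then show ?thesis using x y by (simp add: permutes_not_in)
  qed
qed

section \<open>Postorder and stack-sorting\<close>

text \<open>Justifies the definite description: the rank function of \<open>before\<close> has the
  required properties, and any function that has them increases along \<open>before\<close>.\<close>

lemma postorder_props:
  assumes "(T, \<sigma>) \<in> decreasing_permutrees \<delta>"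
  shows "linear_extension T (postorder T)"
    and "\<And>x y. \<lbrakk>x \<in> verts T; y \<in> verts T; \<not> tree_le T x y; \<not> tree_le T y x; label T x < label T y\<rbrakk>
      \<Longrightarrow> postorder T x < postorder T y"
proof -
  interpret permutree_poset "arrows T" "\<lambda>v. int (label T v)"
    "\<lambda>v. up_wall \<delta> (label T v)" "\<lambda>v. down_wall \<delta> (label T v)" "verts T" \<sigma>
    using assms by (rule decreasing_permutree_poset)
  let ?V = "verts T"
  let ?P = "\<lambda>\<tau>. linear_extension T \<tau> \<and> (\<forall>x\<in>?V. \<forall>y\<in>?V.
    \<not> tree_le T x y \<and> \<not> tree_le T y x \<and> label T x < label T y \<longrightarrow> \<tau> x < \<tau> y)"
  define r where "r x = card {y \<in> ?V. y = x \<or> before y x}" for x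
  have r: "bij_betw r ?V {1..card ?V}" "\<And>x y. \<lbrakk>x \<in> ?V; y \<in> ?V; before x y\<rbrakk> \<Longrightarrow> r x < r y"
    using bij_betw_rank[of ?V before] finite_V before_irrefl before_total before_trans
    unfolding r_def by blast+
  have le: "tree_le T x y \<longleftrightarrow> x = y \<or> (x, y) \<in> (arrows T)\<^sup>+" for x y
    by (auto simp: tree_le_def rtrancl_eq_or_trancl)
  have "?P (restrict r ?V)"
  proof (intro conjI ballI impI)
    fix x y assume V: "x \<in> ?V" "y \<in> ?V" and
      inc: "\<not> tree_le T x y \<and> \<not> tree_le T y x \<and> label T x < label T y"
    then have "before x y" by (auto simp: le before_def)
    then show "restrict r ?V x < restrict r ?V y" using r(2) V by simp
  next
    have "r x \<le> r y" if "x \<in> ?V" "y \<in> ?V" "tree_le T x y" for x y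
      using that r(2)[of x y] by (auto simp: le before_def)
    then show "linear_extension T (restrict r ?V)"
      using r(1) unfolding linear_extension_def by (auto simp: bij_betw_restrict_eq)
  qed
  moreover have "\<tau> = restrict r ?V" if P: "?P \<tau>" for \<tau>
  proof
    fix x
    have ext: "\<tau> \<in> extensional ?V" and bij: "bij_betw \<tau> ?V {1..card ?V}"
      using P by (auto simp: linear_extension_def)
    show "\<tau> x = restrict r ?V x"
    proof (cases "x \<in> ?V")
      case True
      have less: "\<tau> u < \<tau> v" if "u \<in> ?V" "v \<in> ?V" "before u v" for u v
      proof (cases "tree_le T u v")
        case True
        then have "\<tau> u \<le> \<tau> v" using P that by (auto simp: linear_extension_def)
        moreover have "\<tau> u \<noteq> \<tau> v"
          using bij that before_irrefl by (auto simp: bij_betw_def dest: inj_onD)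
        ultimately show ?thesis by simp
      next
        case False
        then have "\<not> tree_le T v u" "label T u < label T v" using that by (auto simp: le before_def)
        then show ?thesis using P that False by blast
      qed
      \<comment> \<open>As \<open>before\<close> is total, \<tau> induces exactly this order, so
        both functions count the same initial segment.\<close>
      have "{y \<in> ?V. \<tau> y \<le> \<tau> x} = {y \<in> ?V. y = x \<or> before y x}"
        using less[OF _ True] less[OF True] before_total[OF True] by force
      then show ?thesis using rank_eq[OF bij True] True by (simp add: r_def)
    next
      case False
      then show ?thesis using ext by (simp add: extensional_def)
    qed
  qed
  ultimately have "?P (postorder T)" unfolding postorder_def by (rule theI)
  then show "linear_extension T (postorder T)"
    and "\<And>x y. \<lbrakk>x \<in> ?V; y \<in> ?V; \<not> tree_le T x y; \<not> tree_le T y x; label T x < label T y\<rbrakk>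
      \<Longrightarrow> postorder T x < postorder T y"
    by blast+
qed

lemma in_order_reading_permutes:
  assumes "(T, \<sigma>) \<in> decreasing_permutrees \<delta>"
  shows "in_order_reading (T, \<sigma>) permutes {1..length \<delta>}"
proof (rule bij_imp_permutes)
  let ?r = "in_order_reading (T, \<sigma>)"
  have T: "permutree \<delta> T" and \<sigma>: "bij_betw \<sigma> (verts T) {1..length \<delta>}"
    using assms card_verts_permutree[of \<delta> T]
    by (auto simp: decreasing_permutrees_def linear_extension_def)
  have l: "bij_betw (label T) (verts T) {1..length \<delta>}" using T by (simp add: permutree_def)
  have "bij_betw (\<sigma> \<circ> inv_into (verts T) (label T)) {1..length \<delta>} {1..length \<delta>}"
    using bij_betw_trans[OF bij_betw_inv_into[OF l] \<sigma>] .
  then show "bij_betw ?r {1..length \<delta>} {1..length \<delta>}"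
    using card_verts_permutree[OF T] by (subst bij_betw_cong[where g = "\<sigma> \<circ> inv_into (verts T) (label T)"]) auto
  show "?r i = i" if "i \<notin> {1..length \<delta>}" for i using that card_verts_permutree[OF T] by auto
qed

text \<open>The class consists of the in-order readings of the linear extensions of one tree.
  Conversely to uniqueness of the tree for a given reading, an isomorphism carries the linear
  extension of one skeleton to the other.\<close>

lemma permutree_class_iff:
  assumes w: "w permutes {1..length \<delta>}" and v: "v permutes {1..length \<delta>}"
  shows "v \<in> permutree_class \<delta> w \<longleftrightarrow>
    linear_extension (skel \<delta> w) (restrict (v \<circ> label (skel \<delta> w)) (verts (skel \<delta> w)))"
proof -
  obtain T \<sigma> where T: "in_order_inv \<delta> w = (T, \<sigma>)" by (cases "in_order_inv \<delta> w")
  obtain T' \<sigma>' where T': "in_order_inv \<delta> v = (T', \<sigma>')" by (cases "in_order_inv \<delta> v")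
  have dec: "(T, \<sigma>) \<in> decreasing_permutrees \<delta>" "(T', \<sigma>') \<in> decreasing_permutrees \<delta>"
    using in_order_inv(1)[OF w] in_order_inv(1)[OF v] T T' by auto
  then have P: "permutree \<delta> T" "permutree \<delta> T'" and ext: "linear_extension T' \<sigma>'"
    by (auto simp: decreasing_permutrees_def)
  let ?\<tau> = "restrict (v \<circ> label T) (verts T)"
  have "same_labelled_tree T' T \<longleftrightarrow> linear_extension T ?\<tau>"
  proof
    assume "linear_extension T ?\<tau>"
    then have "(T, ?\<tau>) \<in> decreasing_permutrees \<delta>" using P by (simp add: decreasing_permutrees_def)
    moreover have "in_order_reading (T, ?\<tau>) = v" using P(1) v by (rule in_order_reading_eqI) simp
    moreover have "in_order_reading (T', \<sigma>') = v" using in_order_inv(2)[OF v] T' by metis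
    ultimately show "same_labelled_tree T' T"
      using same_labelled_tree_if_same_reading[OF dec(2)] by metis
  next
    assume "same_labelled_tree T' T"
    then obtain f where f: "bij_betw f (verts T') (verts T)"
      and arrows: "\<And>x y. \<lbrakk>x \<in> verts T'; y \<in> verts T'\<rbrakk> \<Longrightarrow> (x, y) \<in> arrows T' \<longleftrightarrow> (f x, f y) \<in> arrows T"
      and label: "\<And>x. x \<in> verts T' \<Longrightarrow> label T (f x) = label T' x"
      unfolding same_labelled_tree_def by blast
    have read: "v (label T (f x)) = \<sigma>' x" if "x \<in> verts T'" for x
      using in_order_reading_label[OF P(2) that, of \<sigma>'] in_order_inv(2)[OF v] T' label[OF that] by metis
    have l: "bij_betw (label T) (verts T) {1..length \<delta>}" using P by (simp add: permutree_def)
    have "bij_betw (v \<circ> label T) (verts T) {1..card (verts T)}"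
      using bij_betw_trans[OF l permutes_imp_bij[OF v]] card_verts_permutree[OF P(1)] by simp
    moreover have "v (label T x) \<le> v (label T y)" if "tree_le T x y" "x \<in> verts T" for x y
      using that(1) unfolding tree_le_def
    proof (induction rule: rtrancl_induct)
      case (step y z)
      have "y \<in> verts T" "z \<in> verts T"
        using step.hyps P(1) by (auto simp: permutree_def directed_tree_def)
      then obtain y' z' where yz: "y = f y'" "z = f z'" "y' \<in> verts T'" "z' \<in> verts T'"
        using f unfolding bij_betw_def by (metis imageE)
      then have "(y', z') \<in> arrows T'" using arrows step.hyps by blast
      then have "\<sigma>' y' \<le> \<sigma>' z'"
        using ext yz unfolding linear_extension_def tree_le_def by blast
      then show ?case using step.IH read yz by simp
    qed simp
    ultimately show "linear_extension T ?\<tau>"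
      unfolding linear_extension_def by (auto simp: bij_betw_restrict_eq)
  qed
  then show ?thesis
    unfolding permutree_class_def permutree_congruent_def skel_def using v by (simp add: T T')
qed

text \<open>The postorder reading order inverts only pairs that every linear extension inverts. So
  its inversion set lies in that of each member of the class, which makes it the least
  element.\<close>

lemma pi_down_eq_postorder:
  assumes w: "w permutes {1..length \<delta>}"
  shows "pi_down \<delta> w = in_order_reading (skel \<delta> w, postorder (skel \<delta> w))"
proof -
  obtain T \<sigma> where T: "in_order_inv \<delta> w = (T, \<sigma>)" by (cases "in_order_inv \<delta> w")
  then have skel: "skel \<delta> w = T" by (simp add: skel_def)
  have dec: "(T, \<sigma>) \<in> decreasing_permutrees \<delta>" using in_order_inv(1)[OF w] T by simp
  then have P: "permutree \<delta> T" by (simp add: decreasing_permutrees_def)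
  have l: "bij_betw (label T) (verts T) {1..length \<delta>}" using P by (simp add: permutree_def)
  let ?n = "length \<delta>" and ?x = "in_order_reading (T, postorder T)" and ?C = "permutree_class \<delta> w"
  have post: "linear_extension T (postorder T)" by (rule postorder_props(1)[OF dec])
  then have "(T, postorder T) \<in> decreasing_permutrees \<delta>" using P by (simp add: decreasing_permutrees_def)
  then have x: "?x permutes {1..?n}" by (rule in_order_reading_permutes)
  have x_label: "?x (label T v) = postorder T v" if "v \<in> verts T" for v
    using in_order_reading_label[OF P that] .
  have "restrict (?x \<circ> label T) (verts T) = postorder T"
    using post x_label by (intro extensionalityI[where A = "verts T"]) (auto simp: linear_extension_def)
  then have xC: "?x \<in> ?C" using permutree_class_iff[OF w x] post by (simp add: skel)
  have inv_sub: "inversions ?n ?x \<subseteq> inversions ?n y" and yperm: "y permutes {1..?n}" if y: "y \<in> ?C" for y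
  proof -
    show y': "y permutes {1..?n}" using y by (simp add: permutree_class_def)
    have lin: "linear_extension T (restrict (y \<circ> label T) (verts T))"
      using permutree_class_iff[OF w y'] y by (simp add: skel)
    show "inversions ?n ?x \<subseteq> inversions ?n y"
    proof (rule subrelI)
      fix i j assume ij: "(i, j) \<in> inversions ?n ?x"
      then have mem: "i \<in> {1..?n}" "j \<in> {1..?n}" "i < j" "?x j < ?x i" unfolding inversions_def by blast+
      obtain a b where ab: "a \<in> verts T" "b \<in> verts T" "i = label T a" "j = label T b"
        using mem(1,2) l unfolding bij_betw_def by (metis imageE)
      have pb: "postorder T b < postorder T a" using mem(4) x_label ab by simp
      \<comment> \<open>The postorder lists incomparable vertices by increasing label, so the
        inverted pair is comparable, with the larger label below.\<close>
      have "tree_le T b a"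
      proof (rule ccontr)
        assume no: "\<not> tree_le T b a"
        have "\<not> tree_le T a b"
        proof
          assume "tree_le T a b"
          then have "postorder T a \<le> postorder T b" using post ab unfolding linear_extension_def by blast
          then show False using pb by simp
        qed
        then show False using postorder_props(2)[OF dec ab(1,2)] no mem(3) ab pb by auto
      qed
      then have "restrict (y \<circ> label T) (verts T) b \<le> restrict (y \<circ> label T) (verts T) a"
        using lin ab unfolding linear_extension_def by blast
      then have "y j \<le> y i" using ab by simp
      moreover have "y i \<noteq> y j" using permutes_inj[OF y'] mem(3) by (auto dest: injD)
      ultimately show "(i, j) \<in> inversions ?n y" using mem unfolding inversions_def by auto
    qed
  qed
  have least: "left_weak_le ?n ?x y" if "y \<in> ?C" for y
    using left_weak_le_iff[OF x yperm[OF that]] inv_sub[OF that] by blast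
  have min: "y = ?x" if "y \<in> ?C" "left_weak_le ?n y ?x" for y
    using left_weak_le_iff[OF yperm[OF that(1)] x] inv_sub[OF that(1)] that(2)
      inversions_inject[OF yperm[OF that(1)] x] by blast
  have "pi_down \<delta> w = ?x"
    unfolding pi_down_def
  proof (rule the_equality)
    show "?x \<in> ?C \<and> (\<forall>y\<in>?C. left_weak_le ?n y ?x \<longrightarrow> y = ?x)" using xC min by blast
  qed (use xC least in metis)
  then show ?thesis by (simp only: skel)
qed

text \<open>With \<open>pi_down\<close> known, the identity is a cancellation: the inverse of the
  minimal element sends the postorder position of a vertex to its label, and \<open>w\<close> sends
  this label to its value under the linear extension.\<close>

theorem proposition6p4:
  fixes \<delta> :: "decoration list" and n :: nat
  assumes "length \<delta> = n"
  shows "\<forall>w \<in> {w. w permutes {1..n}}.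
    permutree_stack_sort \<delta> w = (postorder_reading \<circ> in_order_inv \<delta>) w"
proof
  fix w assume "w \<in> {w. w permutes {1..n}}"
  then have w: "w permutes {1..length \<delta>}" using assms by simp
  obtain T \<sigma> where T: "in_order_inv \<delta> w = (T, \<sigma>)" by (cases "in_order_inv \<delta> w")
  then have skel: "skel \<delta> w = T" by (simp add: skel_def)
  have dec: "(T, \<sigma>) \<in> decreasing_permutrees \<delta>" using in_order_inv(1)[OF w] T by simp
  then have P: "permutree \<delta> T" by (simp add: decreasing_permutrees_def)
  note card = card_verts_permutree[OF P]
  let ?x = "in_order_reading (T, postorder T)"
  have post: "linear_extension T (postorder T)" by (rule postorder_props(1)[OF dec])
  then have "(T, postorder T) \<in> decreasing_permutrees \<delta>" using P by (simp add: decreasing_permutrees_def)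
  then have x: "?x permutes {1..length \<delta>}" by (rule in_order_reading_permutes)
  have "(w \<circ> inv ?x) i = postorder_reading (T, \<sigma>) i" for i
  proof (cases "i \<in> {1..length \<delta>}")
    case True
    have "postorder T ` verts T = {1..length \<delta>}"
      using post card by (simp add: linear_extension_def bij_betw_def)
    then have i: "i \<in> postorder T ` verts T" using True by (simp only:)
    define v where "v = inv_into (verts T) (postorder T) i"
    have v: "v \<in> verts T" "postorder T v = i"
      unfolding v_def using i by (rule inv_into_into, rule f_inv_into_f)
    have "?x (label T v) = i" using in_order_reading_label[OF P v(1), of "postorder T"] v(2) by metis
    then have "inv ?x i = label T v" using permutes_inverses(2)[OF x] by metis
    moreover have "w (label T v) = \<sigma> v"
      using in_order_reading_label[OF P v(1), of \<sigma>] in_order_inv(2)[OF w] T by metis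
    ultimately show ?thesis using True card by (simp add: v_def)
  next
    case False
    \<comment> \<open>Outside the index range, all the functions involved are the identity by
      convention.\<close>
    then have "inv ?x i = i" "w i = i" using permutes_not_in[OF permutes_inv[OF x]] permutes_not_in[OF w] by auto
    then show ?thesis using False card by auto
  qed
  then show "permutree_stack_sort \<delta> w = (postorder_reading \<circ> in_order_inv \<delta>) w"
    unfolding permutree_stack_sort_def pi_down_eq_postorder[OF w] comp_apply T skel by (rule ext)
qed

end
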